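(* Let $G$ be a group, $A=\bigoplus_{g\in G}A_g$ a $G$-graded ring, and $M$ a $G$-graded left $A$-module. The graded ring $B=\operatorname{END}_A(M)$ is epsilon-strongly graded if and only if $M\sim_{\mathrm{sd}}M(l)$ for all $l\in\operatorname{supp}(B)$.
   Context: Rings are associative and unital, modules unital. $\mathcal{C}$ denotes the category of $G$-graded left $A$-modules $M=\bigoplus_{g\in G}M_g$ ($A_gM_h\subseteq M_{gh}$) with morphisms the $A$-linear maps $f$ with $f(M_g)\subseteq N_g$ for all $g$. For $l\in G$, $M(l)$ is the module $M$ with grading $M(l)_g=M_{gl}$. An $A$-linear map $f:M\to N$ is graded of degree $l$ if $f(M_g)\subseteq N_{gl}$ for all $g\in G$; the additive group of these is $\operatorname{Mor}_A(M,N)_l$. $\operatorname{END}_A(M)=\bigoplus_{l\in G}\operatorname{Mor}_A(M,M)_l$ is a $G$-graded ring with usual addition and multiplication $uv=v\circ u$. $\operatorname{supp}(B)=\{l\in G:B_l\neq0\}$. A $G$-graded ring $B$ is epsilon-strongly graded if for every $g\in G$ there is $\epsilon_g\in B_gB_{g^{-1}}$ (finite sums of products) with $\epsilon_gb=b=b\epsilon_{g^{-1}}$ for all $b\in B_g$. $N\in\mathcal{C}$ divides $M\in\mathcal{C}$ (written $N\mid M$) if $N$ is isomorphic in $\mathcal{C}$ to a graded direct summand of $M^{(n)}$ for some $n\in\mathbb{N}=\{1,2,\dots\}$. For a non-zero graded direct summand $N'$ of $N$, with projection $\pi_{N'}:N\to N'$ and inclusion $\iota_{N'}:N'\to N$ (morphisms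 in $\mathcal{C}$, for a given graded decomposition), put $\epsilon_{N'}=\iota_{N'}\circ\pi_{N'}\in\operatorname{End}_{\mathcal{C}}(N)$. $N$ semi-divides $M$ (written $N\mid_{\mathrm{sd}}M$) if there is a non-zero graded direct summand $N'$ of $N$ such that $N'\mid M$ in $\mathcal{C}$, and $\epsilon_{N'}\circ f=f$ and $g\circ\epsilon_{N'}=g$ for all $f\in\operatorname{Mor}_{\mathcal{C}}(M,N)$ and $g\in\operatorname{Mor}_{\mathcal{C}}(N,M)$. $M\sim_{\mathrm{sd}}N$ means $N\mid_{\mathrm{sd}}M$ and $M\mid_{\mathrm{sd}}N$. *)

theory Defs
  imports "HOL-Algebra.AbelCoset" "HOL-Algebra.Module"
begin

text \<open>
  Gradings are stored as families of subsets indexed by the type of group elements; only their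
  values on \<open>carrier G\<close> matter. Rings need not be commutative, so the library's \<open>module\<close> locale
  (which assumes a commutative ring) is replaced by \<open>left_module\<close>; the \<open>module\<close> record type is
  kept, with its multiplication and unit fields unused, as in the library.
\<close>

record ('a, 'g) graded_ring = "'a ring" +
  rcomp :: "'g \<Rightarrow> 'a set"

record ('a, 'm, 'g) graded_module = "('a, 'm) module" +
  mcomp :: "'g \<Rightarrow> 'm set"

definition internal_direct_sum :: "('a, 'x) ring_scheme \<Rightarrow> 'i set \<Rightarrow> ('i \<Rightarrow> 'a set) \<Rightarrow> bool"
  where "internal_direct_sum P I C \<longleftrightarrow>
    (\<forall>i\<in>I. additive_subgroup (C i) P) \<and>
    (\<forall>x\<in>carrier P. \<exists>!c. c \<in> (\<Pi>\<^sub>E i\<in>I. C i) \<and> finite {i \<in> I. c i \<noteq> \<zero>\<^bsub>P\<^esub>} \<and>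
       x = (\<Oplus>\<^bsub>P\<^esub> i\<in>{i \<in> I. c i \<noteq> \<zero>\<^bsub>P\<^esub>}. c i))"

locale graded_ring = group G + ring R
  for G :: "('g, 'x) monoid_scheme" and R :: "('a, 'g, 'y) graded_ring_scheme" +
  assumes ring_direct_sum: "internal_direct_sum R (carrier G) (rcomp R)"
    and ring_comp_mult: "\<lbrakk>g \<in> carrier G; h \<in> carrier G; a \<in> rcomp R g; b \<in> rcomp R h\<rbrakk>
      \<Longrightarrow> a \<otimes>\<^bsub>R\<^esub> b \<in> rcomp R (g \<otimes>\<^bsub>G\<^esub> h)"

definition supp :: "('g, 'x) monoid_scheme \<Rightarrow> ('a, 'g, 'y) graded_ring_scheme \<Rightarrow> 'g set"
  where "supp G R = {l \<in> carrier G. rcomp R l \<noteq> {\<zero>\<^bsub>R\<^esub>}}"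

definition product_set :: "('a, 'y) ring_scheme \<Rightarrow> 'a set \<Rightarrow> 'a set \<Rightarrow> 'a set"
  where "product_set R X Y =
    {s. \<exists>(n::nat) x y. x \<in> {..<n} \<rightarrow> X \<and> y \<in> {..<n} \<rightarrow> Y \<and> s = (\<Oplus>\<^bsub>R\<^esub> i\<in>{..<n}. x i \<otimes>\<^bsub>R\<^esub> y i)}"

locale epsilon_strongly_graded_ring = graded_ring G R
  for G :: "('g, 'x) monoid_scheme" and R :: "('a, 'g, 'y) graded_ring_scheme" +
  assumes epsilon: "\<exists>\<epsilon>. \<forall>g\<in>carrier G.
    \<epsilon> g \<in> product_set R (rcomp R g) (rcomp R (inv\<^bsub>G\<^esub> g)) \<and>
    (\<forall>b\<in>rcomp R g. \<epsilon> g \<otimes>\<^bsub>R\<^esub> b = b \<and> b = b \<otimes>\<^bsub>R\<^esub> \<epsilon> (inv\<^bsub>G\<^esub> g))"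

locale left_module = R: ring R + M: abelian_group M
  for R :: "('a, 'y) ring_scheme" and M :: "('a, 'm, 'z) module_scheme" +
  assumes smult_closed: "\<lbrakk>a \<in> carrier R; x \<in> carrier M\<rbrakk> \<Longrightarrow> a \<odot>\<^bsub>M\<^esub> x \<in> carrier M"
    and smult_l_distr: "\<lbrakk>a \<in> carrier R; b \<in> carrier R; x \<in> carrier M\<rbrakk>
      \<Longrightarrow> (a \<oplus>\<^bsub>R\<^esub> b) \<odot>\<^bsub>M\<^esub> x = a \<odot>\<^bsub>M\<^esub> x \<oplus>\<^bsub>M\<^esub> b \<odot>\<^bsub>M\<^esub> x"
    and smult_r_distr: "\<lbrakk>a \<in> carrier R; x \<in> carrier M; y \<in> carrier M\<rbrakk>
      \<Longrightarrow> a \<odot>\<^bsub>M\<^esub> (x \<oplus>\<^bsub>M\<^esub> y) = a \<odot>\<^bsub>M\<^esub> x \<oplus>\<^bsub>M\<^esub> a \<odot>\<^bsub>M\<^esub> y"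
    and smult_assoc: "\<lbrakk>a \<in> carrier R; b \<in> carrier R; x \<in> carrier M\<rbrakk>
      \<Longrightarrow> (a \<otimes>\<^bsub>R\<^esub> b) \<odot>\<^bsub>M\<^esub> x = a \<odot>\<^bsub>M\<^esub> (b \<odot>\<^bsub>M\<^esub> x)"
    and smult_one: "x \<in> carrier M \<Longrightarrow> \<one>\<^bsub>R\<^esub> \<odot>\<^bsub>M\<^esub> x = x"

locale graded_left_module = graded_ring G A + left_module A M
  for G :: "('g, 'x) monoid_scheme" and A :: "('a, 'g, 'y) graded_ring_scheme"
    and M :: "('a, 'm, 'g, 'z) graded_module_scheme" +
  assumes module_direct_sum: "internal_direct_sum M (carrier G) (mcomp M)"
    and module_comp_smult: "\<lbrakk>g \<in> carrier G; h \<in> carrier G; a \<in> rcomp A g; x \<in> mcomp M h\<rbrakk>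
      \<Longrightarrow> a \<odot>\<^bsub>M\<^esub> x \<in> mcomp M (g \<otimes>\<^bsub>G\<^esub> h)"

definition shift :: "('g, 'x) monoid_scheme \<Rightarrow> ('a, 'm, 'g, 'z) graded_module_scheme \<Rightarrow> 'g
    \<Rightarrow> ('a, 'm, 'g, 'z) graded_module_scheme"
  where "shift G M l = M\<lparr>mcomp := (\<lambda>g. mcomp M (g \<otimes>\<^bsub>G\<^esub> l))\<rparr>"

text \<open>Maps are extensional (\<open>undefined\<close> off the carrier), so that equality of functions is
  equality of maps on the carrier.\<close>

definition linear_maps :: "('a, 'y) ring_scheme \<Rightarrow> ('a, 'm, 'z) module_scheme
    \<Rightarrow> ('a, 'n, 'w) module_scheme \<Rightarrow> ('m \<Rightarrow> 'n) set"
  where "linear_maps R M N = {f \<in> carrier M \<rightarrow>\<^sub>E carrier N.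
    (\<forall>x\<in>carrier M. \<forall>y\<in>carrier M. f (x \<oplus>\<^bsub>M\<^esub> y) = f x \<oplus>\<^bsub>N\<^esub> f y) \<and>
    (\<forall>a\<in>carrier R. \<forall>x\<in>carrier M. f (a \<odot>\<^bsub>M\<^esub> x) = a \<odot>\<^bsub>N\<^esub> f x)}"

definition Mor\<^sub>C :: "('g, 'x) monoid_scheme \<Rightarrow> ('a, 'g, 'y) graded_ring_scheme
    \<Rightarrow> ('a, 'm, 'g, 'z) graded_module_scheme \<Rightarrow> ('a, 'n, 'g, 'w) graded_module_scheme
    \<Rightarrow> ('m \<Rightarrow> 'n) set"
  where "Mor\<^sub>C G A M N = {f \<in> linear_maps A M N. \<forall>g\<in>carrier G. f ` mcomp M g \<subseteq> mcomp N g}"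

definition Mor_deg :: "('g, 'x) monoid_scheme \<Rightarrow> ('a, 'g, 'y) graded_ring_scheme
    \<Rightarrow> ('a, 'm, 'g, 'z) graded_module_scheme \<Rightarrow> ('a, 'n, 'g, 'w) graded_module_scheme
    \<Rightarrow> 'g \<Rightarrow> ('m \<Rightarrow> 'n) set"
  where "Mor_deg G A M N l =
    {f \<in> linear_maps A M N. \<forall>g\<in>carrier G. f ` mcomp M g \<subseteq> mcomp N (g \<otimes>\<^bsub>G\<^esub> l)}"

text \<open>The direct sum of the groups of graded endomorphisms is formed inside the ring of all
  \<open>A\<close>-linear endomorphisms. Note the order of composition in the product.\<close>

definition END :: "('g, 'x) monoid_scheme \<Rightarrow> ('a, 'g, 'y) graded_ring_scheme
    \<Rightarrow> ('a, 'm, 'g, 'z) graded_module_scheme \<Rightarrow> ('m \<Rightarrow> 'm, 'g) graded_ring"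
  where "END G A M = \<lparr>
    carrier = {f. \<exists>F u. finite F \<and> F \<subseteq> carrier G \<and> u \<in> (\<Pi> l\<in>F. Mor_deg G A M M l) \<and>
      f = (\<lambda>x\<in>carrier M. \<Oplus>\<^bsub>M\<^esub> l\<in>F. u l x)},
    mult = (\<lambda>u v. compose (carrier M) v u),
    one = (\<lambda>x\<in>carrier M. x),
    zero = (\<lambda>x\<in>carrier M. \<zero>\<^bsub>M\<^esub>),
    add = (\<lambda>u v. \<lambda>x\<in>carrier M. u x \<oplus>\<^bsub>M\<^esub> v x),
    rcomp = Mor_deg G A M M\<rparr>"

definition isomorphic\<^sub>C :: "('g, 'x) monoid_scheme \<Rightarrow> ('a, 'g, 'y) graded_ring_scheme
    \<Rightarrow> ('a, 'm, 'g, 'z) graded_module_scheme \<Rightarrow> ('a, 'n, 'g, 'w) graded_module_scheme \<Rightarrow> bool"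
  where "isomorphic\<^sub>C G A M N \<longleftrightarrow> (\<exists>f\<in>Mor\<^sub>C G A M N. \<exists>h\<in>Mor\<^sub>C G A N M.
    compose (carrier M) h f = (\<lambda>x\<in>carrier M. x) \<and> compose (carrier N) f h = (\<lambda>x\<in>carrier N. x))"

definition power_module :: "nat \<Rightarrow> ('a, 'm, 'g, 'z) graded_module_scheme
    \<Rightarrow> ('a, nat \<Rightarrow> 'm, 'g) graded_module"
  where "power_module n M = \<lparr>
    carrier = (\<Pi>\<^sub>E i\<in>{..<n}. carrier M),
    mult = undefined,
    one = undefined,
    zero = (\<lambda>i\<in>{..<n}. \<zero>\<^bsub>M\<^esub>),
    add = (\<lambda>x y. \<lambda>i\<in>{..<n}. x i \<oplus>\<^bsub>M\<^esub> y i),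
    smult = (\<lambda>a x. \<lambda>i\<in>{..<n}. a \<odot>\<^bsub>M\<^esub> x i),
    mcomp = (\<lambda>g. \<Pi>\<^sub>E i\<in>{..<n}. mcomp M g)\<rparr>"

definition restrict_module :: "('a, 'm, 'g, 'z) graded_module_scheme \<Rightarrow> 'm set
    \<Rightarrow> ('a, 'm, 'g, 'z) graded_module_scheme"
  where "restrict_module M K = M\<lparr>carrier := K, mcomp := (\<lambda>g. mcomp M g \<inter> K)\<rparr>"

definition graded_submodule :: "('g, 'x) monoid_scheme \<Rightarrow> ('a, 'g, 'y) graded_ring_scheme
    \<Rightarrow> 'm set \<Rightarrow> ('a, 'm, 'g, 'z) graded_module_scheme \<Rightarrow> bool"
  where "graded_submodule G A K M \<longleftrightarrow>
    K \<subseteq> carrier M \<and> graded_left_module G A (restrict_module M K)"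

definition graded_decomposition :: "('g, 'x) monoid_scheme \<Rightarrow> ('a, 'g, 'y) graded_ring_scheme
    \<Rightarrow> ('a, 'm, 'g, 'z) graded_module_scheme \<Rightarrow> 'm set \<Rightarrow> 'm set \<Rightarrow> bool"
  where "graded_decomposition G A M K L \<longleftrightarrow>
    graded_submodule G A K M \<and> graded_submodule G A L M \<and>
    (\<forall>x\<in>carrier M. \<exists>!(y, z). y \<in> K \<and> z \<in> L \<and> x = y \<oplus>\<^bsub>M\<^esub> z)"

definition divides\<^sub>C :: "('g, 'x) monoid_scheme \<Rightarrow> ('a, 'g, 'y) graded_ring_scheme
    \<Rightarrow> ('a, 'n, 'g, 'w) graded_module_scheme \<Rightarrow> ('a, 'm, 'g, 'z) graded_module_scheme \<Rightarrow> bool"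
  where "divides\<^sub>C G A N M \<longleftrightarrow> (\<exists>n\<ge>1. \<exists>K L.
    graded_decomposition G A (power_module n M) K L \<and>
    isomorphic\<^sub>C G A N (restrict_module (power_module n M) K))"

definition projection :: "('a, 'm, 'g, 'z) graded_module_scheme \<Rightarrow> 'm set \<Rightarrow> 'm set \<Rightarrow> 'm \<Rightarrow> 'm"
  where "projection M K L = (\<lambda>x\<in>carrier M. THE y. y \<in> K \<and> (\<exists>z\<in>L. x = y \<oplus>\<^bsub>M\<^esub> z))"

definition inclusion :: "'m set \<Rightarrow> 'm \<Rightarrow> 'm"
  where "inclusion K = (\<lambda>x\<in>K. x)"

definition summand_idempotent :: "('a, 'm, 'g, 'z) graded_module_scheme \<Rightarrow> 'm set \<Rightarrow> 'm set
    \<Rightarrow> 'm \<Rightarrow> 'm"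
  where "summand_idempotent M K L = compose (carrier M) (inclusion K) (projection M K L)"

text \<open>The decomposition \<open>N = N' \<oplus> L\<close> defining the idempotent is chosen together with \<open>N'\<close>.\<close>

definition semi_divides :: "('g, 'x) monoid_scheme \<Rightarrow> ('a, 'g, 'y) graded_ring_scheme
    \<Rightarrow> ('a, 'n, 'g, 'w) graded_module_scheme \<Rightarrow> ('a, 'm, 'g, 'z) graded_module_scheme \<Rightarrow> bool"
  where "semi_divides G A N M \<longleftrightarrow> (\<exists>N' L.
    graded_decomposition G A N N' L \<and> N' \<noteq> {\<zero>\<^bsub>N\<^esub>} \<and>
    divides\<^sub>C G A (restrict_module N N') M \<and>
    (\<forall>f\<in>Mor\<^sub>C G A M N. compose (carrier M) (summand_idempotent N N' L) f = f) \<and>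
    (\<forall>h\<in>Mor\<^sub>C G A N M. compose (carrier N) h (summand_idempotent N N' L) = h))"

definition semi_equivalent :: "('g, 'x) monoid_scheme \<Rightarrow> ('a, 'g, 'y) graded_ring_scheme
    \<Rightarrow> ('a, 'm, 'g, 'z) graded_module_scheme \<Rightarrow> ('a, 'n, 'g, 'w) graded_module_scheme \<Rightarrow> bool"
  where "semi_equivalent G A M N \<longleftrightarrow> semi_divides G A N M \<and> semi_divides G A M N"

end

theory Submission
  imports Defs "HOL-Algebra.Subrings"
begin

text \<open>
  The key observation is that \<open>N\<close> semi-divides \<open>M\<close> exactly when there is a non-zero endomorphism
  \<open>e\<close> of \<open>N\<close> of the form \<open>v\<^sub>1 \<circ> u\<^sub>1 + \<dots> + v\<^sub>n \<circ> u\<^sub>n\<close> with \<open>u\<^sub>i\<close> from \<open>N\<close> to \<open>M\<close> and \<open>v\<^sub>i\<close> from \<open>M\<close> to \<open>N\<close>,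
  such that \<open>e \<circ> f = f\<close> for all \<open>f\<close> from \<open>M\<close> to \<open>N\<close> and \<open>h \<circ> e = h\<close> for all \<open>h\<close> from \<open>N\<close> to \<open>M\<close>.
  Such an \<open>e\<close> is automatically idempotent, its image is the summand \<open>N'\<close>, and the \<open>u\<^sub>i\<close> and \<open>v\<^sub>i\<close>
  assemble to maps between \<open>N\<close> and \<open>M\<^sup>n\<close> that identify \<open>N'\<close> with a summand of \<open>M\<^sup>n\<close>.

  A morphism from \<open>M\<close> to \<open>M(l)\<close> is an element of \<open>B\<^sub>l\<close>, and one from \<open>M(l)\<close> to \<open>M\<close> is an
  element of \<open>B\<close> of degree \<open>l\<close> inverse. Under this dictionary the condition above for \<open>M\<close> and \<open>M(l)\<close>
  is the condition on \<open>\<epsilon>\<^sub>l\<close>, and for \<open>M(l)\<close> and \<open>M\<close> it is the one on \<open>\<epsilon>\<close> at \<open>l\<close> inverse. Outside the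
  support one takes \<open>\<epsilon> = 0\<close>, which is consistent because the support turns out to be closed under
  inverses: otherwise the non-zero \<open>e\<close> above would factor through zero maps.
\<close>

section \<open>Subgroups, additive maps and finite sums across records\<close>

text \<open>Inverses are expressed through addition and zero alone, avoiding \<open>a_inv\<close>,
  whose definition refers to the carrier. Being a subgroup thus passes directly between records that
  share carrier, addition and zero, as a module and its shifts do.\<close>

lemma additive_subgroup_iff:
  assumes "abelian_group P"
  shows "additive_subgroup H P \<longleftrightarrow> H \<subseteq> carrier P \<and> \<zero>\<^bsub>P\<^esub> \<in> H \<and>
    (\<forall>x\<in>H. \<forall>y\<in>H. x \<oplus>\<^bsub>P\<^esub> y \<in> H) \<and> (\<forall>x\<in>H. \<exists>y\<in>H. y \<oplus>\<^bsub>P\<^esub> x = \<zero>\<^bsub>P\<^esub>)"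
proof -
  interpret abelian_group P by fact
  show ?thesis
  proof (intro iffI conjI ballI)
    assume "additive_subgroup H P"
    then interpret additive_subgroup H P .
    show "H \<subseteq> carrier P" by (rule a_subset)
    show "\<zero>\<^bsub>P\<^esub> \<in> H" by simp
    show "x \<oplus>\<^bsub>P\<^esub> y \<in> H" if "x \<in> H" "y \<in> H" for x y using that by simp
    show "\<exists>y\<in>H. y \<oplus>\<^bsub>P\<^esub> x = \<zero>\<^bsub>P\<^esub>" if "x \<in> H" for x
      using that a_subset add.subgroupE(3)[OF a_subgroup] l_neg by blast
  next
    assume H: "H \<subseteq> carrier P \<and> \<zero>\<^bsub>P\<^esub> \<in> H \<and>
      (\<forall>x\<in>H. \<forall>y\<in>H. x \<oplus>\<^bsub>P\<^esub> y \<in> H) \<and> (\<forall>x\<in>H. \<exists>y\<in>H. y \<oplus>\<^bsub>P\<^esub> x = \<zero>\<^bsub>P\<^esub>)"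
    have "\<ominus>\<^bsub>P\<^esub> x \<in> H" if "x \<in> H" for x
      using that H minus_equality by (metis subsetD)
    then show "additive_subgroup H P"
      using H by (intro additive_subgroupI add.subgroupI) auto
  qed
qed

lemma additive_map_zero:
  assumes "abelian_group P" "abelian_group Q" "f \<in> carrier P \<rightarrow> carrier Q"
    "\<And>x y. \<lbrakk>x \<in> carrier P; y \<in> carrier P\<rbrakk> \<Longrightarrow> f (x \<oplus>\<^bsub>P\<^esub> y) = f x \<oplus>\<^bsub>Q\<^esub> f y"
  shows "f \<zero>\<^bsub>P\<^esub> = \<zero>\<^bsub>Q\<^esub>"
proof -
  interpret P: abelian_group P by fact
  interpret Q: abelian_group Q by fact
  have c: "f \<zero>\<^bsub>P\<^esub> \<in> carrier Q" using assms(3) by auto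
  have "f \<zero>\<^bsub>P\<^esub> \<oplus>\<^bsub>Q\<^esub> f \<zero>\<^bsub>P\<^esub> = f \<zero>\<^bsub>P\<^esub>"
    using assms(4)[of "\<zero>\<^bsub>P\<^esub>" "\<zero>\<^bsub>P\<^esub>"] by simp
  then show ?thesis using c by simp
qed

lemma additive_map_finsum:
  assumes "abelian_group P" "abelian_group Q" "f \<in> carrier P \<rightarrow> carrier Q"
    "\<And>x y. \<lbrakk>x \<in> carrier P; y \<in> carrier P\<rbrakk> \<Longrightarrow> f (x \<oplus>\<^bsub>P\<^esub> y) = f x \<oplus>\<^bsub>Q\<^esub> f y"
    and "finite F" "c \<in> F \<rightarrow> carrier P"
  shows "f (\<Oplus>\<^bsub>P\<^esub>i\<in>F. c i) = (\<Oplus>\<^bsub>Q\<^esub>i\<in>F. f (c i))"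
proof -
  interpret P: abelian_group P by fact
  interpret Q: abelian_group Q by fact
  show ?thesis
    using assms(5,6)
  proof (induction F)
    case empty
    then show ?case using additive_map_zero[OF assms(1-4)] by simp
  next
    case (insert i F)
    have fc: "(\<lambda>i. f (c i)) \<in> F \<rightarrow> carrier Q" "f (c i) \<in> carrier Q"
      using insert.prems assms(3) by auto
    have c: "c i \<in> carrier P" "c \<in> F \<rightarrow> carrier P" "(\<Oplus>\<^bsub>P\<^esub>i\<in>F. c i) \<in> carrier P"
      using insert.prems by auto
    have "f (\<Oplus>\<^bsub>P\<^esub>i\<in>insert i F. c i) = f (c i \<oplus>\<^bsub>P\<^esub> (\<Oplus>\<^bsub>P\<^esub>i\<in>F. c i))"
      using insert.hyps c by (simp add: P.finsum_insert)
    also have "\<dots> = f (c i) \<oplus>\<^bsub>Q\<^esub> (\<Oplus>\<^bsub>Q\<^esub>i\<in>F. f (c i))"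
      using assms(4) c insert.IH by simp
    also have "\<dots> = (\<Oplus>\<^bsub>Q\<^esub>i\<in>insert i F. f (c i))"
      using insert.hyps fc by (simp add: Q.finsum_insert)
    finally show ?case .
  qed
qed

text \<open>\<open>finsum\<close> depends on the whole record, so a sum in a submodule, a shift or a
  subring has to be identified with the ambient sum. Over an infinite index set both sides are zero
  by convention.\<close>

lemma finsum_agree:
  assumes "abelian_monoid P" "abelian_monoid Q" "carrier Q \<subseteq> carrier P"
    "add Q = add P" "\<zero>\<^bsub>Q\<^esub> = \<zero>\<^bsub>P\<^esub>" "c \<in> F \<rightarrow> carrier Q"
  shows "finsum Q c F = finsum P c F"
proof (cases "finite F")
  interpret P: abelian_monoid P by fact
  interpret Q: abelian_monoid Q by fact
  case True
  then show ?thesis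
    using assms(6)
  proof (induction F)
    case empty
    then show ?case using assms(5) by simp
  next
    case (insert i F)
    have "c \<in> F \<rightarrow> carrier P" "c i \<in> carrier P" using insert.prems assms(3) by auto
    then show ?case using insert assms(4) by (simp add: P.finsum_insert Q.finsum_insert Pi_iff)
  qed
next
  interpret P: abelian_monoid P by fact
  interpret Q: abelian_monoid Q by fact
  case False
  then show ?thesis using assms(5) by (simp add: P.finsum_infinite Q.finsum_infinite)
qed

lemma finsum_diff:
  assumes "abelian_group P" "finite F" "c \<in> F \<rightarrow> carrier P" "d \<in> F \<rightarrow> carrier P"
  shows "(\<Oplus>\<^bsub>P\<^esub>i\<in>F. c i \<ominus>\<^bsub>P\<^esub> d i) = finsum P c F \<ominus>\<^bsub>P\<^esub> finsum P d F"
proof -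
  interpret P: abelian_group P by fact
  have "(\<Oplus>\<^bsub>P\<^esub>i\<in>F. \<ominus>\<^bsub>P\<^esub> d i) = \<ominus>\<^bsub>P\<^esub> finsum P d F"
    using additive_map_finsum[of P P "\<lambda>x. \<ominus>\<^bsub>P\<^esub> x" F d] assms
    by (auto simp: P.minus_add P.abelian_group_axioms P.a_comm)
  then show ?thesis
    unfolding a_minus_def using P.finsum_addf[of c F "\<lambda>i. \<ominus>\<^bsub>P\<^esub> d i"] assms(3,4)
    by (simp add: Pi_iff)
qed

lemma (in abelian_monoid) finsum_single: "x \<in> carrier G \<Longrightarrow> finsum G (\<lambda>_. x) {i} = x"
  by (simp add: finsum_insert)

section \<open>Direct sums\<close>

lemma internal_direct_sum_subset:
  "\<lbrakk>internal_direct_sum P I C; i \<in> I\<rbrakk> \<Longrightarrow> C i \<subseteq> carrier P"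
  by (simp add: internal_direct_sum_def additive_subgroup.a_subset)

lemma internal_direct_sum_span:
  assumes "internal_direct_sum P I C" "x \<in> carrier P"
  obtains F c where "finite F" "F \<subseteq> I" "c \<in> Pi F C" "x = finsum P c F"
proof -
  obtain c where "c \<in> (\<Pi>\<^sub>E i\<in>I. C i)" "finite {i \<in> I. c i \<noteq> \<zero>\<^bsub>P\<^esub>}"
    "x = finsum P c {i \<in> I. c i \<noteq> \<zero>\<^bsub>P\<^esub>}"
    using assms unfolding internal_direct_sum_def by blast
  then show ?thesis by (intro that[of "{i \<in> I. c i \<noteq> \<zero>\<^bsub>P\<^esub>}" c]) auto
qed

text \<open>The family c padded by zeros and the zero family are both expansions of zero over I, so
  uniqueness of expansions makes them equal.\<close>

lemma internal_direct_sum_indep: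
  assumes "abelian_group P" "internal_direct_sum P I C"
    and F: "finite F" "F \<subseteq> I" "c \<in> Pi F C" "finsum P c F = \<zero>\<^bsub>P\<^esub>" and "i \<in> F"
  shows "c i = \<zero>\<^bsub>P\<^esub>"
proof -
  interpret abelian_group P by fact
  have zero: "\<zero>\<^bsub>P\<^esub> \<in> C j" and sub: "C j \<subseteq> carrier P" if "j \<in> I" for j
    using that assms(2) unfolding internal_direct_sum_def
    by (auto simp: additive_subgroup.zero_closed dest: additive_subgroup.a_subset)
  define d where "d = (\<lambda>j\<in>I. if j \<in> F then c j else \<zero>\<^bsub>P\<^esub>)"
  have cc: "c \<in> F \<rightarrow> carrier P" using F sub by (auto simp: Pi_iff) 
  have supp: "{j \<in> I. d j \<noteq> \<zero>\<^bsub>P\<^esub>} \<subseteq> F" by (auto simp: d_def)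
  \<comment> \<open>The definition of a direct sum adds over the exact support, which may be smaller
    than F; only zero terms are dropped.\<close>
  have "finsum P d {j \<in> I. d j \<noteq> \<zero>\<^bsub>P\<^esub>} = finsum P c F"
    by (rule add.finprod_mono_neutral_cong_left)
      (use F supp cc in \<open>auto simp: d_def\<close>)
  moreover have "finsum P (\<lambda>j\<in>I. \<zero>\<^bsub>P\<^esub>) {j \<in> I. (\<lambda>j\<in>I. \<zero>\<^bsub>P\<^esub>) j \<noteq> \<zero>\<^bsub>P\<^esub>} = \<zero>\<^bsub>P\<^esub>"
    by (simp add: finsum_zero cong: conj_cong)
  moreover have "d \<in> (\<Pi>\<^sub>E j\<in>I. C j)" "(\<lambda>j\<in>I. \<zero>\<^bsub>P\<^esub>) \<in> (\<Pi>\<^sub>E j\<in>I. C j)"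
    using F zero by (auto simp: d_def Pi_iff)
  moreover have "finite {j \<in> I. d j \<noteq> \<zero>\<^bsub>P\<^esub>}" "finite {j \<in> I. (\<lambda>j\<in>I. \<zero>\<^bsub>P\<^esub>) j \<noteq> \<zero>\<^bsub>P\<^esub>}"
    using supp F(1) finite_subset by (auto cong: conj_cong)
  moreover have "\<exists>!c. c \<in> (\<Pi>\<^sub>E i\<in>I. C i) \<and> finite {i \<in> I. c i \<noteq> \<zero>\<^bsub>P\<^esub>} \<and>
       \<zero>\<^bsub>P\<^esub> = (\<Oplus>\<^bsub>P\<^esub> i\<in>{i \<in> I. c i \<noteq> \<zero>\<^bsub>P\<^esub>}. c i)" (is "\<exists>!c. ?Q c")
    using assms(2) unfolding internal_direct_sum_def by simp
  ultimately have "?Q d" "?Q (\<lambda>j\<in>I. \<zero>\<^bsub>P\<^esub>)" "\<exists>!c. ?Q c"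
    using F(4) by (simp_all only:)
  then have "d = (\<lambda>j\<in>I. \<zero>\<^bsub>P\<^esub>)"
    using the1_equality[OF \<open>\<exists>!c. ?Q c\<close>, of d]
      the1_equality[OF \<open>\<exists>!c. ?Q c\<close>, of "\<lambda>j\<in>I. \<zero>\<^bsub>P\<^esub>"] by (simp only:)
  then have "d i = (\<lambda>j\<in>I. \<zero>\<^bsub>P\<^esub>) i" by simp
  then show ?thesis using \<open>i \<in> F\<close> F(2) by (auto simp: d_def)
qed

text \<open>In applications the indices are group elements and \<phi> is a translation, so c i lies
  in the component of index \<phi> i rather than i. Injectivity puts the terms into distinct
  components, and independence is applied to the family pulled back along the inverse of
  \<phi>.\<close>

lemma internal_direct_sum_indep_reindex:
  assumes "abelian_group P" "internal_direct_sum P I C" "finite F" "inj_on \<phi> F" "\<phi> ` F \<subseteq> I"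
    and c: "\<And>i. i \<in> F \<Longrightarrow> c i \<in> C (\<phi> i)" and s: "finsum P c F = \<zero>\<^bsub>P\<^esub>" and i: "i \<in> F"
  shows "c i = \<zero>\<^bsub>P\<^esub>"
proof -
  interpret abelian_group P by fact
  let ?c = "\<lambda>j. c (inv_into F \<phi> j)"
  have inv: "inv_into F \<phi> (\<phi> j) = j" if "j \<in> F" for j using assms(4) that by simp
  have cP: "c j \<in> carrier P" if "j \<in> F" for j
    using internal_direct_sum_subset[OF assms(2), of "\<phi> j"] c[OF that] assms(5) that by blast
  have "finsum P ?c (\<phi> ` F) = (\<Oplus>\<^bsub>P\<^esub>j\<in>F. ?c (\<phi> j))"
    by (rule finsum_reindex[OF _ assms(4)]) (use cP inv in auto)
  also have "\<dots> = finsum P c F"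
    using cP inv by (intro finsum_cong') auto
  finally have "finsum P ?c (\<phi> ` F) = \<zero>\<^bsub>P\<^esub>" using s by simp
  then have "?c (\<phi> i) = \<zero>\<^bsub>P\<^esub>"
    by (rule internal_direct_sum_indep[OF assms(1,2) _ assms(5), rotated 2])
      (use assms(3) i c inv in auto)
  then show ?thesis using inv[OF i] by simp
qed

text \<open>Reduces unique existence of expansions to spanning and independence: the termwise
  differences of two expansions of x stay in the components and sum to zero, so \<open>indep\<close>
  makes them vanish.\<close>

lemma internal_direct_sumI:
  assumes "abelian_group P" and sub: "\<And>i. i \<in> I \<Longrightarrow> additive_subgroup (C i) P"
    and span: "\<And>x. x \<in> carrier P \<Longrightarrow>
      \<exists>F c. finite F \<and> F \<subseteq> I \<and> c \<in> Pi F C \<and> x = finsum P c F"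
    and indep: "\<And>F c i. \<lbrakk>finite F; F \<subseteq> I; c \<in> Pi F C; finsum P c F = \<zero>\<^bsub>P\<^esub>; i \<in> F\<rbrakk>
      \<Longrightarrow> c i = \<zero>\<^bsub>P\<^esub>"
  shows "internal_direct_sum P I C"
  unfolding internal_direct_sum_def
proof (intro conjI ballI)
  interpret abelian_group P by fact
  have zero: "\<zero>\<^bsub>P\<^esub> \<in> C j" and carr: "C j \<subseteq> carrier P" if "j \<in> I" for j
    using that sub by (auto simp: additive_subgroup.zero_closed dest: additive_subgroup.a_subset)
  have minus: "x \<ominus>\<^bsub>P\<^esub> y \<in> C j" if "j \<in> I" "x \<in> C j" "y \<in> C j" for x y j
    using sub[OF that(1)] that(2,3) add.subgroupE(3,4)[OF additive_subgroup.a_subgroup]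
    by (auto simp: a_minus_def)
  show "additive_subgroup (C i) P" if "i \<in> I" for i using that by (rule sub)
  fix x assume "x \<in> carrier P"
  show "\<exists>!c. c \<in> (\<Pi>\<^sub>E i\<in>I. C i) \<and> finite {i \<in> I. c i \<noteq> \<zero>\<^bsub>P\<^esub>} \<and>
       x = (\<Oplus>\<^bsub>P\<^esub> i\<in>{i \<in> I. c i \<noteq> \<zero>\<^bsub>P\<^esub>}. c i)"
  proof (rule ex_ex1I)
    obtain F c where F: "finite F" "F \<subseteq> I" "c \<in> Pi F C" "x = finsum P c F"
      using span[OF \<open>x \<in> carrier P\<close>] by blast
    define d where "d = (\<lambda>j\<in>I. if j \<in> F then c j else \<zero>\<^bsub>P\<^esub>)"
    have cc: "c \<in> F \<rightarrow> carrier P" using F carr by (auto simp: Pi_iff)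
    have supp: "{j \<in> I. d j \<noteq> \<zero>\<^bsub>P\<^esub>} \<subseteq> F" by (auto simp: d_def)
    have "finsum P d {j \<in> I. d j \<noteq> \<zero>\<^bsub>P\<^esub>} = finsum P c F"
      by (rule add.finprod_mono_neutral_cong_left)
        (use F supp cc in \<open>auto simp: d_def\<close>)
    moreover have "d \<in> (\<Pi>\<^sub>E j\<in>I. C j)"
      using F zero by (auto simp: d_def Pi_iff)
    ultimately show "\<exists>c. c \<in> (\<Pi>\<^sub>E i\<in>I. C i) \<and> finite {i \<in> I. c i \<noteq> \<zero>\<^bsub>P\<^esub>} \<and>
       x = (\<Oplus>\<^bsub>P\<^esub> i\<in>{i \<in> I. c i \<noteq> \<zero>\<^bsub>P\<^esub>}. c i)"
      using F(1,4) supp finite_subset by (intro exI[of _ d]) auto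
  next
    fix c d
    assume c: "c \<in> (\<Pi>\<^sub>E i\<in>I. C i) \<and> finite {i \<in> I. c i \<noteq> \<zero>\<^bsub>P\<^esub>} \<and>
       x = (\<Oplus>\<^bsub>P\<^esub> i\<in>{i \<in> I. c i \<noteq> \<zero>\<^bsub>P\<^esub>}. c i)"
      and d: "d \<in> (\<Pi>\<^sub>E i\<in>I. C i) \<and> finite {i \<in> I. d i \<noteq> \<zero>\<^bsub>P\<^esub>} \<and>
       x = (\<Oplus>\<^bsub>P\<^esub> i\<in>{i \<in> I. d i \<noteq> \<zero>\<^bsub>P\<^esub>}. d i)"
    \<comment> \<open>The union of both supports carries both expansions, so that they can be
      subtracted term by term; the added terms are zero.\<close>
    define F where "F = {i \<in> I. c i \<noteq> \<zero>\<^bsub>P\<^esub>} \<union> {i \<in> I. d i \<noteq> \<zero>\<^bsub>P\<^esub>}"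
    have F: "finite F" "F \<subseteq> I" using c d by (auto simp: F_def)
    have carr': "c j \<in> carrier P" "d j \<in> carrier P" if "j \<in> I" for j
      using that c d carr by (blast dest: PiE_mem)+
    have "x = finsum P c F"
      by (subst conjunct2[OF conjunct2[OF c]], rule add.finprod_mono_neutral_cong_left)
        (use F carr' in \<open>auto simp: F_def\<close>)
    moreover have "x = finsum P d F"
      by (subst conjunct2[OF conjunct2[OF d]], rule add.finprod_mono_neutral_cong_left)
        (use F carr' in \<open>auto simp: F_def\<close>)
    ultimately have s: "(\<Oplus>\<^bsub>P\<^esub>i\<in>F. c i \<ominus>\<^bsub>P\<^esub> d i) = \<zero>\<^bsub>P\<^esub>"
      using finsum_diff[OF assms(1) F(1), of c d] F(2) carr' \<open>x \<in> carrier P\<close>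
      by (simp add: a_minus_def r_neg Pi_iff subset_eq)
    have "c i = d i" if "i \<in> I" for i
    proof (cases "i \<in> F")
      case True
      have "c i \<ominus>\<^bsub>P\<^esub> d i = \<zero>\<^bsub>P\<^esub>"
        using F s True c d minus by (intro indep[of F "\<lambda>i. c i \<ominus>\<^bsub>P\<^esub> d i"]) (auto simp: PiE_mem subset_eq)
      then show ?thesis
        using carr'[OF that] by (metis a_minus_def minus_equality minus_minus a_inv_closed)
    next
      case False
      then show ?thesis using that by (auto simp: F_def)
    qed
    then show "c = d" using c d by (auto intro: PiE_ext)
  qed
qed

section \<open>Graded modules\<close>

lemma linear_mapsI:
  assumes "f \<in> carrier M \<rightarrow>\<^sub>E carrier N"
    "\<And>x y. \<lbrakk>x \<in> carrier M; y \<in> carrier M\<rbrakk> \<Longrightarrow> f (x \<oplus>\<^bsub>M\<^esub> y) = f x \<oplus>\<^bsub>N\<^esub> f y"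
    "\<And>a x. \<lbrakk>a \<in> carrier R; x \<in> carrier M\<rbrakk> \<Longrightarrow> f (a \<odot>\<^bsub>M\<^esub> x) = a \<odot>\<^bsub>N\<^esub> f x"
  shows "f \<in> linear_maps R M N"
  using assms unfolding linear_maps_def by simp

lemma linear_mapsD:
  assumes "f \<in> linear_maps R M N"
  shows "f \<in> carrier M \<rightarrow> carrier N" "f \<in> extensional (carrier M)"
    "x \<in> carrier M \<Longrightarrow> f x \<in> carrier N"
    "\<lbrakk>x \<in> carrier M; y \<in> carrier M\<rbrakk> \<Longrightarrow> f (x \<oplus>\<^bsub>M\<^esub> y) = f x \<oplus>\<^bsub>N\<^esub> f y"
    "\<lbrakk>a \<in> carrier R; x \<in> carrier M\<rbrakk> \<Longrightarrow> f (a \<odot>\<^bsub>M\<^esub> x) = a \<odot>\<^bsub>N\<^esub> f x"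
  using assms unfolding linear_maps_def by (auto simp: PiE_iff)

lemma linear_maps_zero:
  assumes "f \<in> linear_maps R M N" "left_module R M" "left_module R N"
  shows "f \<zero>\<^bsub>M\<^esub> = \<zero>\<^bsub>N\<^esub>"
proof -
  interpret M: left_module R M by fact
  interpret N: left_module R N by fact
  show ?thesis
    using linear_mapsD[OF assms(1)]
    by (intro additive_map_zero M.M.abelian_group_axioms N.M.abelian_group_axioms) auto
qed

lemma linear_maps_finsum:
  assumes "f \<in> linear_maps R M N" "left_module R M" "left_module R N"
    and "finite F" "c \<in> F \<rightarrow> carrier M"
  shows "f (\<Oplus>\<^bsub>M\<^esub>i\<in>F. c i) = (\<Oplus>\<^bsub>N\<^esub>i\<in>F. f (c i))"
proof -
  interpret M: left_module R M by fact
  interpret N: left_module R N by fact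
  show ?thesis
    using linear_mapsD[OF assms(1)] assms(4,5)
    by (intro additive_map_finsum M.M.abelian_group_axioms N.M.abelian_group_axioms) auto
qed

lemma (in left_module) linear_maps_compose:
  assumes "f \<in> linear_maps R M N" "h \<in> linear_maps R N P"
  shows "compose (carrier M) h f \<in> linear_maps R M P"
  using linear_mapsD[OF assms(1)] linear_mapsD[OF assms(2)]
  by (intro linear_mapsI) (auto simp: compose_def smult_closed)

lemma Mor\<^sub>CI:
  assumes "f \<in> linear_maps A M N"
    "\<And>g x. \<lbrakk>g \<in> carrier G; x \<in> mcomp M g\<rbrakk> \<Longrightarrow> f x \<in> mcomp N g"
  shows "f \<in> Mor\<^sub>C G A M N"
  using assms unfolding Mor\<^sub>C_def by auto

lemma Mor\<^sub>CD:
  assumes "f \<in> Mor\<^sub>C G A M N"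
  shows "f \<in> linear_maps A M N"
    "\<lbrakk>g \<in> carrier G; x \<in> mcomp M g\<rbrakk> \<Longrightarrow> f x \<in> mcomp N g"
  using assms unfolding Mor\<^sub>C_def by auto

lemma graded_left_moduleI:
  assumes "graded_ring G A" "abelian_group M"
    and "\<And>a x. \<lbrakk>a \<in> carrier A; x \<in> carrier M\<rbrakk> \<Longrightarrow> a \<odot>\<^bsub>M\<^esub> x \<in> carrier M"
    and "\<And>a b x. \<lbrakk>a \<in> carrier A; b \<in> carrier A; x \<in> carrier M\<rbrakk>
      \<Longrightarrow> (a \<oplus>\<^bsub>A\<^esub> b) \<odot>\<^bsub>M\<^esub> x = a \<odot>\<^bsub>M\<^esub> x \<oplus>\<^bsub>M\<^esub> b \<odot>\<^bsub>M\<^esub> x"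
    and "\<And>a x y. \<lbrakk>a \<in> carrier A; x \<in> carrier M; y \<in> carrier M\<rbrakk>
      \<Longrightarrow> a \<odot>\<^bsub>M\<^esub> (x \<oplus>\<^bsub>M\<^esub> y) = a \<odot>\<^bsub>M\<^esub> x \<oplus>\<^bsub>M\<^esub> a \<odot>\<^bsub>M\<^esub> y"
    and "\<And>a b x. \<lbrakk>a \<in> carrier A; b \<in> carrier A; x \<in> carrier M\<rbrakk>
      \<Longrightarrow> (a \<otimes>\<^bsub>A\<^esub> b) \<odot>\<^bsub>M\<^esub> x = a \<odot>\<^bsub>M\<^esub> (b \<odot>\<^bsub>M\<^esub> x)"
    and "\<And>x. x \<in> carrier M \<Longrightarrow> \<one>\<^bsub>A\<^esub> \<odot>\<^bsub>M\<^esub> x = x"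
    and "internal_direct_sum M (carrier G) (mcomp M)"
    and "\<And>g h a x. \<lbrakk>g \<in> carrier G; h \<in> carrier G; a \<in> rcomp A g; x \<in> mcomp M h\<rbrakk>
      \<Longrightarrow> a \<odot>\<^bsub>M\<^esub> x \<in> mcomp M (g \<otimes>\<^bsub>G\<^esub> h)"
  shows "graded_left_module G A M"
proof -
  interpret graded_ring G A by fact
  show ?thesis
    using assms ring_axioms
    by (intro graded_left_module.intro left_module.intro left_module_axioms.intro
        graded_left_module_axioms.intro) auto
qed

lemma (in graded_ring) rcomp_subset: "g \<in> carrier G \<Longrightarrow> rcomp R g \<subseteq> carrier R"
  using internal_direct_sum_subset[OF ring_direct_sum] .

context graded_left_module
begin

lemma mcomp_subset: "g \<in> carrier G \<Longrightarrow> mcomp M g \<subseteq> carrier M"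
  using internal_direct_sum_subset[OF module_direct_sum] .

lemma mcomp_subgroup: "g \<in> carrier G \<Longrightarrow> additive_subgroup (mcomp M g) M"
  using module_direct_sum unfolding internal_direct_sum_def by simp

lemma mcomp_closed:
  assumes "g \<in> carrier G"
  shows "\<zero>\<^bsub>M\<^esub> \<in> mcomp M g"
    "\<lbrakk>x \<in> mcomp M g; y \<in> mcomp M g\<rbrakk> \<Longrightarrow> x \<oplus>\<^bsub>M\<^esub> y \<in> mcomp M g"
    "x \<in> mcomp M g \<Longrightarrow> \<ominus>\<^bsub>M\<^esub> x \<in> mcomp M g"
  using mcomp_subgroup[OF assms] M.add.subgroupE(3)[of "mcomp M g"]
  by (auto simp: additive_subgroup.zero_closed additive_subgroup.a_closed
      dest: additive_subgroup.a_subgroup)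

lemma finsum_mcomp:
  assumes "g \<in> carrier G" "finite F" "c \<in> F \<rightarrow> mcomp M g"
  shows "finsum M c F \<in> mcomp M g"
  using assms(2,3)
proof (induction F)
  case empty
  then show ?case using mcomp_closed(1)[OF assms(1)] by simp
next
  case (insert i F)
  then have "c \<in> F \<rightarrow> carrier M" "c i \<in> carrier M" using mcomp_subset[OF assms(1)] by auto
  then show ?case
    using insert mcomp_closed(2)[OF assms(1)] by (simp add: M.finsum_insert Pi_iff)
qed

lemma span_mcomp:
  assumes "x \<in> carrier M"
  obtains F c where "finite F" "F \<subseteq> carrier G" "c \<in> Pi F (mcomp M)" "c \<in> F \<rightarrow> carrier M"
    "x = finsum M c F"
proof -
  obtain F c where "finite F" "F \<subseteq> carrier G" "c \<in> Pi F (mcomp M)" "x = finsum M c F"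
    using internal_direct_sum_span[OF module_direct_sum assms] .
  moreover then have "c \<in> F \<rightarrow> carrier M" using mcomp_subset by (auto simp: Pi_iff)
  ultimately show ?thesis using that by blast
qed

lemmas indep_mcomp = internal_direct_sum_indep[OF M.abelian_group_axioms module_direct_sum]

text \<open>Homogeneous elements span, and linear maps respect finite sums.\<close>

lemma linear_maps_cong_mcomp:
  assumes "left_module A N" "f \<in> linear_maps A M N" "h \<in> linear_maps A M N"
    and eq: "\<And>g x. \<lbrakk>g \<in> carrier G; x \<in> mcomp M g\<rbrakk> \<Longrightarrow> f x = h x"
  shows "f = h"
proof (rule extensionalityI[OF linear_mapsD(2)[OF assms(2)] linear_mapsD(2)[OF assms(3)]])
  interpret N: left_module A N by fact
  fix x assume "x \<in> carrier M"
  then obtain F c where F: "finite F" "F \<subseteq> carrier G" "c \<in> Pi F (mcomp M)" "c \<in> F \<rightarrow> carrier M"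
    "x = finsum M c F" by (rule span_mcomp)
  have "f x = (\<Oplus>\<^bsub>N\<^esub>i\<in>F. f (c i))"
    using linear_maps_finsum[OF assms(2) left_module_axioms assms(1) F(1,4)] F(5) by simp
  also have "\<dots> = (\<Oplus>\<^bsub>N\<^esub>i\<in>F. h (c i))"
    using F eq linear_mapsD(3)[OF assms(3)] by (intro N.M.finsum_cong') (auto simp: Pi_iff subset_eq)
  also have "\<dots> = h x"
    using linear_maps_finsum[OF assms(3) left_module_axioms assms(1) F(1,4)] F(5) by simp
  finally show "f x = h x" .
qed

text \<open>Independence of the components is inherited from M. What makes the submodule graded is
  \<open>span\<close>: the homogeneous components of an element of K can be chosen inside K.\<close>

lemma graded_submoduleI:
  assumes K: "K \<subseteq> carrier M" "\<zero>\<^bsub>M\<^esub> \<in> K"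
    "\<And>x y. \<lbrakk>x \<in> K; y \<in> K\<rbrakk> \<Longrightarrow> x \<oplus>\<^bsub>M\<^esub> y \<in> K" "\<And>x. x \<in> K \<Longrightarrow> \<ominus>\<^bsub>M\<^esub> x \<in> K"
    "\<And>a x. \<lbrakk>a \<in> carrier A; x \<in> K\<rbrakk> \<Longrightarrow> a \<odot>\<^bsub>M\<^esub> x \<in> K"
    and span: "\<And>x. x \<in> K \<Longrightarrow> \<exists>F c. finite F \<and> F \<subseteq> carrier G \<and>
      c \<in> Pi F (\<lambda>g. mcomp M g \<inter> K) \<and> x = finsum M c F"
  shows "graded_submodule G A K M"
proof -
  let ?K = "restrict_module M K"
  have simps [simp]: "carrier ?K = K" "\<zero>\<^bsub>?K\<^esub> = \<zero>\<^bsub>M\<^esub>" "add ?K = add M" "smult ?K = smult M"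
    "mcomp ?K = (\<lambda>g. mcomp M g \<inter> K)"
    by (simp_all add: restrict_module_def)
  have mem [simp]: "x \<in> K \<Longrightarrow> x \<in> carrier M" for x using K(1) by auto
  have ag: "abelian_group ?K"
  proof (rule abelian_groupI)
    show "\<exists>y\<in>carrier ?K. y \<oplus>\<^bsub>?K\<^esub> x = \<zero>\<^bsub>?K\<^esub>" if "x \<in> carrier ?K" for x
      using that K(4) by (auto simp: M.l_neg intro!: bexI[of _ "\<ominus>\<^bsub>M\<^esub> x"])
  qed (use K in \<open>auto simp: M.a_ac\<close>)
  have fs: "finsum ?K c F = finsum M c F" if "c \<in> F \<rightarrow> K" for c and F :: "'g set"
    using that ag M.abelian_monoid_axioms K(1)
    by (intro finsum_agree) (auto simp: abelian_group_def)
  have ids: "internal_direct_sum ?K (carrier G) (mcomp ?K)"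
  proof (rule internal_direct_sumI[OF ag])
    fix g assume g: "g \<in> carrier G"
    have "\<exists>y\<in>mcomp M g \<inter> K. y \<oplus>\<^bsub>M\<^esub> x = \<zero>\<^bsub>M\<^esub>" if "x \<in> mcomp M g \<inter> K" for x
      using that K(4) mcomp_closed(3)[OF g] by (intro bexI[of _ "\<ominus>\<^bsub>M\<^esub> x"]) (auto simp: M.l_neg)
    then show "additive_subgroup (mcomp ?K g) ?K"
      using K(2,3) mcomp_closed(1,2)[OF g] by (simp add: additive_subgroup_iff[OF ag])
  next
    fix x assume "x \<in> carrier ?K"
    then have "x \<in> K" by simp
    then obtain F c where F: "finite F" "F \<subseteq> carrier G" "c \<in> Pi F (\<lambda>g. mcomp M g \<inter> K)"
      "x = finsum M c F" using span by blast
    then show "\<exists>F c. finite F \<and> F \<subseteq> carrier G \<and> c \<in> Pi F (mcomp ?K) \<and> x = finsum ?K c F"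
      using fs[of c F] by (intro exI[of _ F] exI[of _ c]) (auto simp: Pi_iff)
  next
    fix F c i assume "finite F" "F \<subseteq> carrier G" "c \<in> Pi F (mcomp ?K)" "finsum ?K c F = \<zero>\<^bsub>?K\<^esub>"
      "i \<in> F"
    then show "c i = \<zero>\<^bsub>?K\<^esub>"
      using indep_mcomp[of F c i] fs[of c F] by (auto simp: Pi_iff)
  qed
  have "graded_left_module G A ?K"
    by (rule graded_left_moduleI[OF graded_ring_axioms ag _ _ _ _ _ ids])
      (use K module_comp_smult subsetD[OF rcomp_subset] in \<open>auto simp: smult_l_distr smult_r_distr smult_assoc smult_one\<close>)
  then show ?thesis
    unfolding graded_submodule_def using K(1) by simp
qed

lemma smult_zero: "a \<in> carrier A \<Longrightarrow> a \<odot>\<^bsub>M\<^esub> \<zero>\<^bsub>M\<^esub> = \<zero>\<^bsub>M\<^esub>"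
  by (rule additive_map_zero[OF M.abelian_group_axioms M.abelian_group_axioms])
    (auto simp: smult_closed smult_r_distr)

lemma left_module_self: "left_module A M" ..

end

section \<open>Shifts and finite powers of graded modules\<close>

lemma shift_simps [simp]:
  "carrier (shift G M l) = carrier M" "add (shift G M l) = add M"
  "\<zero>\<^bsub>shift G M l\<^esub> = \<zero>\<^bsub>M\<^esub>" "smult (shift G M l) = smult M"
  "mcomp (shift G M l) g = mcomp M (g \<otimes>\<^bsub>G\<^esub> l)"
  by (simp_all add: shift_def)

lemma restrict_module_simps [simp]:
  "carrier (restrict_module M K) = K" "add (restrict_module M K) = add M"
  "\<zero>\<^bsub>restrict_module M K\<^esub> = \<zero>\<^bsub>M\<^esub>" "smult (restrict_module M K) = smult M"
  "mcomp (restrict_module M K) g = mcomp M g \<inter> K"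
  by (simp_all add: restrict_module_def)

lemma power_module_simps [simp]:
  "carrier (power_module n M) = (\<Pi>\<^sub>E i\<in>{..<n}. carrier M)"
  "add (power_module n M) = (\<lambda>x y. \<lambda>i\<in>{..<n}. x i \<oplus>\<^bsub>M\<^esub> y i)"
  "\<zero>\<^bsub>power_module n M\<^esub> = (\<lambda>i\<in>{..<n}. \<zero>\<^bsub>M\<^esub>)"
  "smult (power_module n M) = (\<lambda>a x. \<lambda>i\<in>{..<n}. a \<odot>\<^bsub>M\<^esub> x i)"
  "mcomp (power_module n M) g = (\<Pi>\<^sub>E i\<in>{..<n}. mcomp M g)"
  by (simp_all add: power_module_def)

lemma (in graded_ring) group_G: "group G"
  using graded_ring_axioms by (simp add: graded_ring_def)

lemma (in graded_ring) grade_assoc: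
  "\<lbrakk>g \<in> carrier G; h \<in> carrier G; k \<in> carrier G\<rbrakk>
    \<Longrightarrow> g \<otimes>\<^bsub>G\<^esub> h \<otimes>\<^bsub>G\<^esub> k = g \<otimes>\<^bsub>G\<^esub> (h \<otimes>\<^bsub>G\<^esub> k)"
  by (rule monoid.m_assoc[OF group.axioms(1)[OF group_G]])

context graded_left_module
begin

text \<open>Right translation by l permutes the degrees, so expansions in M only need reindexing.
  The action respects the new degrees because A_g M_{hl} lies in M_{g(hl)} = M_{(gh)l}.\<close>

lemma graded_left_module_shift:
  assumes l: "l \<in> carrier G"
  shows "graded_left_module G A (shift G M l)"
proof -
  let ?S = "shift G M l"
  have ag: "abelian_group ?S"
  proof (rule abelian_groupI)
    show "\<exists>y\<in>carrier ?S. y \<oplus>\<^bsub>?S\<^esub> x = \<zero>\<^bsub>?S\<^esub>" if "x \<in> carrier ?S" for x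
      using that by (intro bexI[of _ "\<ominus>\<^bsub>M\<^esub> x"]) (simp_all add: M.l_neg)
  qed (auto simp: M.a_ac)
  have fs: "finsum ?S c F = finsum M c F" if "c \<in> F \<rightarrow> carrier M" for c and F :: "'c set"
    using that ag M.abelian_monoid_axioms
    by (intro finsum_agree) (auto simp: abelian_group_def)
  have sub: "mcomp M (g \<otimes>\<^bsub>G\<^esub> l) \<subseteq> carrier M" if "g \<in> carrier G" for g
    using mcomp_subset that l by simp
  have inj: "inj_on (\<lambda>g. g \<otimes>\<^bsub>G\<^esub> l) F" if "F \<subseteq> carrier G" for F
    using that l by (auto simp: inj_on_def subset_eq)
  have inj': "inj_on (\<lambda>g. g \<otimes>\<^bsub>G\<^esub> inv\<^bsub>G\<^esub> l) F" if "F \<subseteq> carrier G" for F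
    using that l by (auto simp: inj_on_def subset_eq)
  have ids: "internal_direct_sum ?S (carrier G) (mcomp ?S)"
  proof (rule internal_direct_sumI[OF ag])
    fix g assume g: "g \<in> carrier G"
    then have "additive_subgroup (mcomp M (g \<otimes>\<^bsub>G\<^esub> l)) M"
      using mcomp_subgroup l by simp
    then show "additive_subgroup (mcomp ?S g) ?S"
      by (simp add: additive_subgroup_iff[OF ag] additive_subgroup_iff[OF M.abelian_group_axioms])
  next
    fix x assume "x \<in> carrier ?S"
    then have "x \<in> carrier M" by simp
    then obtain F c where F: "finite F" "F \<subseteq> carrier G" "c \<in> Pi F (mcomp M)"
      "c \<in> F \<rightarrow> carrier M" "x = finsum M c F" by (rule span_mcomp)
    \<comment> \<open>A component of degree g in M has degree g l^{-1} in the shift.\<close>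
    let ?F = "(\<lambda>g. g \<otimes>\<^bsub>G\<^esub> inv\<^bsub>G\<^esub> l) ` F" and ?c = "\<lambda>g. c (g \<otimes>\<^bsub>G\<^esub> l)"
    have c: "?c (g \<otimes>\<^bsub>G\<^esub> inv\<^bsub>G\<^esub> l) = c g" if "g \<in> F" for g
      using that F(2) l by (simp add: grade_assoc subset_eq)
    have cF: "?c \<in> ?F \<rightarrow> carrier M" using F(4) c by auto
    have "finsum M ?c ?F = (\<Oplus>\<^bsub>M\<^esub>g\<in>F. ?c (g \<otimes>\<^bsub>G\<^esub> inv\<^bsub>G\<^esub> l))"
      using cF inj'[OF F(2)] by (rule M.finsum_reindex)
    also have "\<dots> = x" unfolding F(5) using F(4) c by (intro M.finsum_cong') auto
    finally have "x = finsum ?S ?c ?F" using fs[OF cF] by simp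
    moreover have "?F \<subseteq> carrier G" using F(2) l by auto
    moreover have "?c \<in> Pi ?F (mcomp ?S)" using F(2,3) l by (auto simp: grade_assoc Pi_iff subset_eq)
    ultimately show "\<exists>F c. finite F \<and> F \<subseteq> carrier G \<and> c \<in> Pi F (mcomp ?S) \<and> x = finsum ?S c F"
      using F(1) by blast
  next
    fix F c i assume F: "finite F" "F \<subseteq> carrier G" "c \<in> Pi F (mcomp ?S)"
      "finsum ?S c F = \<zero>\<^bsub>?S\<^esub>" "i \<in> F"
    have "c \<in> F \<rightarrow> carrier M" using F(2,3) sub by (auto simp: Pi_iff)
    then have s: "finsum M c F = \<zero>\<^bsub>M\<^esub>" using F(4) fs[of c F] by simp
    have "c i = \<zero>\<^bsub>M\<^esub>"
      by (rule internal_direct_sum_indep_reindex[OF M.abelian_group_axioms module_direct_sum F(1)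
            inj[OF F(2)] _ _ s F(5)])
        (use F(2,3) l in auto)
    then show "c i = \<zero>\<^bsub>?S\<^esub>" by simp
  qed
  show ?thesis
  proof (rule graded_left_moduleI[OF graded_ring_axioms ag _ _ _ _ _ ids])
    fix g h a x assume "g \<in> carrier G" "h \<in> carrier G" "a \<in> rcomp A g" "x \<in> mcomp ?S h"
    then show "a \<odot>\<^bsub>?S\<^esub> x \<in> mcomp ?S (g \<otimes>\<^bsub>G\<^esub> h)"
      using module_comp_smult[of g "h \<otimes>\<^bsub>G\<^esub> l" a x] l by (simp add: grade_assoc)
  qed (auto simp: smult_closed smult_l_distr smult_r_distr smult_assoc smult_one)
qed

lemma abelian_group_power_module: "abelian_group (power_module n M)"
proof (rule abelian_groupI)
  fix x assume "x \<in> carrier (power_module n M)"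
  then show "\<exists>y\<in>carrier (power_module n M). y \<oplus>\<^bsub>power_module n M\<^esub> x = \<zero>\<^bsub>power_module n M\<^esub>"
    by (intro bexI[of _ "\<lambda>i\<in>{..<n}. \<ominus>\<^bsub>M\<^esub> x i"]) (auto simp: M.l_neg PiE_iff intro!: restrict_ext)
qed (auto simp: M.a_ac PiE_iff extensional_def fun_eq_iff)

lemma finsum_power_module:
  assumes "c \<in> F \<rightarrow> carrier (power_module n M)" "finite F"
  shows "finsum (power_module n M) c F = (\<lambda>i\<in>{..<n}. \<Oplus>\<^bsub>M\<^esub>j\<in>F. c j i)"
proof -
  interpret P: abelian_group "power_module n M" by (rule abelian_group_power_module)
  show ?thesis
    using assms(2,1)
  proof (induction F)
    case empty
    then show ?case by simp
  next
    case (insert j F)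
    have c: "c \<in> F \<rightarrow> carrier (power_module n M)" "c j \<in> carrier (power_module n M)"
      using insert.prems by auto
    then have "(\<lambda>j. c j i) \<in> F \<rightarrow> carrier M" "c j i \<in> carrier M" if "i < n" for i
      using that by (auto simp: PiE_iff Pi_iff)
    then show ?case
      unfolding P.finsum_insert[OF insert.hyps c] insert.IH[OF c(1)]
      using insert.hyps by (auto simp: M.finsum_insert intro!: restrict_ext)
  qed
qed

lemma graded_left_module_power: "graded_left_module G A (power_module n M)"
proof -
  let ?P = "power_module n M"
  note ag = abelian_group_power_module[of n]
  have sub: "x i \<in> carrier M" if "x \<in> carrier ?P" "i < n" for x i
    using that by (auto simp: PiE_iff)
  have comp_sub: "mcomp ?P g \<subseteq> carrier ?P" if "g \<in> carrier G" for g
    using mcomp_subset[OF that] by (auto simp: PiE_iff)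
  have ids: "internal_direct_sum ?P (carrier G) (mcomp ?P)"
  proof (rule internal_direct_sumI[OF ag])
    fix g assume g: "g \<in> carrier G"
    have "\<exists>y\<in>mcomp ?P g. y \<oplus>\<^bsub>?P\<^esub> x = \<zero>\<^bsub>?P\<^esub>" if "x \<in> mcomp ?P g" for x
      using that mcomp_closed(3)[OF g] mcomp_subset[OF g]
      by (intro bexI[of _ "\<lambda>i\<in>{..<n}. \<ominus>\<^bsub>M\<^esub> x i"]) (auto simp: M.l_neg PiE_iff subset_eq intro!: restrict_ext)
    then show "additive_subgroup (mcomp ?P g) ?P"
      using mcomp_closed(1,2)[OF g] comp_sub[OF g]
      by (simp add: additive_subgroup_iff[OF ag] PiE_iff)
  next
    fix x assume x: "x \<in> carrier ?P"
    have "\<exists>F c. finite F \<and> F \<subseteq> carrier G \<and> c \<in> Pi F (mcomp M) \<and> x i = finsum M c F" if "i < n" for i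
      using span_mcomp[OF sub[OF x that]] by metis
    then obtain F c where F: "\<And>i. i < n \<Longrightarrow> finite (F i) \<and> F i \<subseteq> carrier G \<and> c i \<in> Pi (F i) (mcomp M)
        \<and> x i = finsum M (c i) (F i)"
      by metis
    \<comment> \<open>Each coordinate has its own finite set of degrees. The vector is expanded over
      the union of these sets, with a zero entry wherever a coordinate lacks the degree.\<close>
    define H where "H = (\<Union>i<n. F i)"
    define d where "d = (\<lambda>g. \<lambda>i\<in>{..<n}. if g \<in> F i then c i g else \<zero>\<^bsub>M\<^esub>)"
    have H: "finite H" "H \<subseteq> carrier G" using F by (auto simp: H_def)
    have d: "d \<in> Pi H (mcomp ?P)"
      using F H mcomp_closed(1) by (auto simp: d_def PiE_iff Pi_iff subset_eq)
    have dM: "d \<in> H \<rightarrow> carrier ?P"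
      using d comp_sub H(2) by (auto simp del: power_module_simps)
    have "finsum ?P d H = (\<lambda>i\<in>{..<n}. \<Oplus>\<^bsub>M\<^esub>g\<in>H. d g i)"
      by (rule finsum_power_module[OF dM H(1)])
    also have "\<dots> = (\<lambda>i\<in>{..<n}. x i)"
    proof (rule restrict_ext)
      fix i assume i: "i \<in> {..<n}"
      then have "x i = finsum M (c i) (F i)" using F by simp
      also have "\<dots> = (\<Oplus>\<^bsub>M\<^esub>g\<in>H. d g i)"
      proof (rule M.add.finprod_mono_neutral_cong_left)
        show "(\<lambda>g. d g i) \<in> H \<rightarrow> carrier M"
          using dM i by (auto simp: Pi_iff PiE_iff)
      qed (use i H in \<open>auto simp: H_def d_def\<close>)
      finally show "(\<Oplus>\<^bsub>M\<^esub>g\<in>H. d g i) = x i" by simp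
    qed
    also have "\<dots> = x" using x by (simp add: PiE_restrict)
    finally show "\<exists>F c. finite F \<and> F \<subseteq> carrier G \<and> c \<in> Pi F (mcomp ?P) \<and> x = finsum ?P c F"
      using H d by metis
  next
    fix F c g assume F: "finite F" "F \<subseteq> carrier G" "c \<in> Pi F (mcomp ?P)"
      "finsum ?P c F = \<zero>\<^bsub>?P\<^esub>" "g \<in> F"
    have cM: "c \<in> F \<rightarrow> carrier ?P"
      using F(2,3) comp_sub by (auto simp del: power_module_simps)
    have e: "(\<lambda>i\<in>{..<n}. \<Oplus>\<^bsub>M\<^esub>g\<in>F. c g i) = (\<lambda>i\<in>{..<n}. \<zero>\<^bsub>M\<^esub>)"
      using F(4) unfolding finsum_power_module[OF cM F(1)] by simp
    have z: "(\<Oplus>\<^bsub>M\<^esub>g\<in>F. c g i) = \<zero>\<^bsub>M\<^esub>" if "i < n" for i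
      using fun_cong[OF e, of i] that by simp
    have "c g i = \<zero>\<^bsub>M\<^esub>" if "i < n" for i
      by (rule indep_mcomp[OF F(1,2) _ z[OF that] F(5)]) (use F(3) that in \<open>auto simp: Pi_iff PiE_iff\<close>)
    moreover have "c g \<in> extensional {..<n}"
      using cM F(5) by (auto simp: PiE_iff Pi_iff)
    ultimately show "c g = \<zero>\<^bsub>?P\<^esub>"
      by (intro extensionalityI[of _ "{..<n}"]) auto
  qed
  show ?thesis
  proof (rule graded_left_moduleI[OF graded_ring_axioms ag _ _ _ _ _ ids])
    fix x assume "x \<in> carrier ?P"
    then show "\<one>\<^bsub>A\<^esub> \<odot>\<^bsub>?P\<^esub> x = x"
      by (intro extensionalityI[of _ "{..<n}"]) (auto simp: smult_one PiE_iff)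
  qed (auto simp: smult_closed smult_l_distr smult_r_distr smult_assoc PiE_iff module_comp_smult
      intro!: restrict_ext)
qed

end

section \<open>Graded direct summands\<close>

lemma (in left_module) linear_maps_neg:
  assumes "f \<in> linear_maps R M N" "left_module R N" "x \<in> carrier M"
  shows "f (\<ominus>\<^bsub>M\<^esub> x) = \<ominus>\<^bsub>N\<^esub> f x"
proof -
  interpret N: left_module R N by fact
  have "f (\<ominus>\<^bsub>M\<^esub> x) \<oplus>\<^bsub>N\<^esub> f x = f \<zero>\<^bsub>M\<^esub>"
    using assms(3) linear_mapsD(4)[OF assms(1), of "\<ominus>\<^bsub>M\<^esub> x" x] by (simp add: M.l_neg)
  then show ?thesis
    using linear_maps_zero[OF assms(1) left_module_axioms assms(2)] linear_mapsD(3)[OF assms(1)]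
      assms(3) by (simp add: N.M.minus_equality)
qed

text \<open>Composing with the inclusion of K changes only the target: maps are extensional on their
  source, so the function itself stays the same.\<close>

lemma Mor\<^sub>C_into_restrict:
  assumes "f \<in> Mor\<^sub>C G A X (restrict_module M K)" "K \<subseteq> carrier M"
  shows "f \<in> Mor\<^sub>C G A X M"
  using Mor\<^sub>CD[OF assms(1)] assms(2) unfolding Mor\<^sub>C_def linear_maps_def by (auto simp: PiE_iff)

context graded_left_module
begin

lemma Mor\<^sub>C_compose:
  assumes "f \<in> Mor\<^sub>C G A M N" "h \<in> Mor\<^sub>C G A N P"
  shows "compose (carrier M) h f \<in> Mor\<^sub>C G A M P"
  using Mor\<^sub>CD[OF assms(1)] Mor\<^sub>CD[OF assms(2)] mcomp_subset
  by (intro Mor\<^sub>CI linear_maps_compose) (auto simp: compose_def subset_eq)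

text \<open>One set F serves for every finite H containing it, so several elements can be expanded
  over a common set of degrees.\<close>

lemma mcomp_components:
  assumes "x \<in> carrier M"
  obtains F where "finite F" "F \<subseteq> carrier G"
    "\<And>H. \<lbrakk>finite H; F \<subseteq> H; H \<subseteq> carrier G\<rbrakk> \<Longrightarrow> \<exists>c\<in>Pi H (mcomp M). x = finsum M c H"
proof -
  obtain F c where F: "finite F" "F \<subseteq> carrier G" "c \<in> Pi F (mcomp M)" "c \<in> F \<rightarrow> carrier M"
    "x = finsum M c F" using assms by (rule span_mcomp)
  show ?thesis
  proof (rule that[OF F(1,2)])
    fix H assume H: "finite H" "F \<subseteq> H" "H \<subseteq> carrier G"
    let ?c = "\<lambda>h. if h \<in> F then c h else \<zero>\<^bsub>M\<^esub>"
    have "x = finsum M ?c H"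
      unfolding F(5) using F(4) by (intro M.add.finprod_mono_neutral_cong_left H(1,2)) auto
    moreover have "?c \<in> Pi H (mcomp M)"
      using F(3) H(3) mcomp_closed(1) by (auto simp: Pi_iff subset_eq)
    ultimately show "\<exists>c\<in>Pi H (mcomp M). x = finsum M c H" by blast
  qed
qed

lemma projection_eq:
  assumes "graded_decomposition G A M K L" "y \<in> K" "z \<in> L"
  shows "projection M K L (y \<oplus>\<^bsub>M\<^esub> z) = y"
proof -
  have "K \<subseteq> carrier M" "L \<subseteq> carrier M"
    using assms(1) by (auto simp: graded_decomposition_def graded_submodule_def)
  then have c: "y \<oplus>\<^bsub>M\<^esub> z \<in> carrier M" using assms by auto
  then have ex: "\<exists>!(y', z'). y' \<in> K \<and> z' \<in> L \<and> y \<oplus>\<^bsub>M\<^esub> z = y' \<oplus>\<^bsub>M\<^esub> z'"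
    using assms(1) unfolding graded_decomposition_def by blast
  have "(THE y'. y' \<in> K \<and> (\<exists>z'\<in>L. y \<oplus>\<^bsub>M\<^esub> z = y' \<oplus>\<^bsub>M\<^esub> z')) = y"
    by (rule the_equality) (use ex assms(2,3) in blast)+
  then show ?thesis using c by (simp add: projection_def)
qed

lemma graded_decompositionE:
  assumes "graded_decomposition G A M K L" "x \<in> carrier M"
  obtains y z where "y \<in> K" "z \<in> L" "x = y \<oplus>\<^bsub>M\<^esub> z"
  using assms unfolding graded_decomposition_def by blast

lemma graded_submodule_closed:
  assumes "graded_submodule G A K M"
  shows "K \<subseteq> carrier M" "\<zero>\<^bsub>M\<^esub> \<in> K" "\<lbrakk>x \<in> K; y \<in> K\<rbrakk> \<Longrightarrow> x \<oplus>\<^bsub>M\<^esub> y \<in> K"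
    "\<lbrakk>a \<in> carrier A; x \<in> K\<rbrakk> \<Longrightarrow> a \<odot>\<^bsub>M\<^esub> x \<in> K"
proof -
  show "K \<subseteq> carrier M" using assms by (simp add: graded_submodule_def)
  interpret K: graded_left_module G A "restrict_module M K"
    using assms by (simp add: graded_submodule_def)
  show "\<zero>\<^bsub>M\<^esub> \<in> K" using K.M.zero_closed by simp
  show "\<lbrakk>x \<in> K; y \<in> K\<rbrakk> \<Longrightarrow> x \<oplus>\<^bsub>M\<^esub> y \<in> K" using K.M.a_closed by simp
  show "\<lbrakk>a \<in> carrier A; x \<in> K\<rbrakk> \<Longrightarrow> a \<odot>\<^bsub>M\<^esub> x \<in> K" using K.smult_closed by simp
qed

text \<open>The components lie in K while the sum is formed in M, so that expansions from two
  complementary submodules can be added to each other.\<close>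

lemma graded_submodule_components:
  assumes K: "graded_submodule G A K M" and "x \<in> K"
  obtains F where "finite F" "F \<subseteq> carrier G"
    "\<And>H. \<lbrakk>finite H; F \<subseteq> H; H \<subseteq> carrier G\<rbrakk>
      \<Longrightarrow> \<exists>c. c \<in> Pi H (mcomp M) \<and> c \<in> H \<rightarrow> K \<and> x = finsum M c H"
proof -
  interpret K: graded_left_module G A "restrict_module M K"
    using K by (simp add: graded_submodule_def)
  have "x \<in> carrier (restrict_module M K)" using \<open>x \<in> K\<close> by simp
  then obtain F where F: "finite F" "F \<subseteq> carrier G"
    "\<And>H. \<lbrakk>finite H; F \<subseteq> H; H \<subseteq> carrier G\<rbrakk>
      \<Longrightarrow> \<exists>c\<in>Pi H (mcomp (restrict_module M K)). x = finsum (restrict_module M K) c H"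
    by (rule K.mcomp_components) blast
  show ?thesis
  proof (rule that[OF F(1,2)])
    fix H assume H: "finite H" "F \<subseteq> H" "H \<subseteq> carrier G"
    obtain c where c: "c \<in> Pi H (mcomp (restrict_module M K))"
      "x = finsum (restrict_module M K) c H" using F(3)[OF H] by blast
    have "c \<in> H \<rightarrow> K" "c \<in> Pi H (mcomp M)" using c(1) by (auto simp: Pi_iff)
    moreover then have "finsum (restrict_module M K) c H = finsum M c H"
      using graded_submodule_closed(1)[OF K]
      by (intro finsum_agree M.abelian_monoid_axioms K.M.abelian_monoid_axioms) auto
    ultimately show "\<exists>c. c \<in> Pi H (mcomp M) \<and> c \<in> H \<rightarrow> K \<and> x = finsum M c H"
      using c(2) by auto
  qed
qed

text \<open>The point is that the projection preserves degrees. If x = y + z is homogeneous of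
  degree g, then in every other degree the components of y and z add up to zero; as the sum of K and
  L is direct, both vanish there, and y is its own component of degree g.\<close>

lemma projection_Mor\<^sub>C:
  assumes D: "graded_decomposition G A M K L"
  shows "projection M K L \<in> Mor\<^sub>C G A M (restrict_module M K)"
    "x \<in> K \<Longrightarrow> projection M K L x = x"
    "summand_idempotent M K L = projection M K L"
proof -
  let ?p = "projection M K L"
  have K: "graded_submodule G A K M" and L: "graded_submodule G A L M"
    using D by (auto simp: graded_decomposition_def)
  note Kc = graded_submodule_closed[OF K] and Lc = graded_submodule_closed[OF L]
  have Kc': "y \<in> K \<Longrightarrow> y \<in> carrier M" and Lc': "y \<in> L \<Longrightarrow> y \<in> carrier M" for y
    using Kc(1) Lc(1) by auto
  show pK: "?p x = x" if "x \<in> K" for x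
    using projection_eq[OF D that Lc(2)] Kc'[OF that] by simp
  have closed: "?p x \<in> K" if x: "x \<in> carrier M" for x
    using x by (rule graded_decompositionE[OF D]) (simp add: projection_eq[OF D])
  have ext: "?p \<in> extensional (carrier M)" by (simp add: projection_def)
  show "summand_idempotent M K L = ?p"
    using closed ext
    by (intro extensionalityI[of _ "carrier M"])
      (auto simp: summand_idempotent_def inclusion_def compose_def)
  show "?p \<in> Mor\<^sub>C G A M (restrict_module M K)"
  proof (intro Mor\<^sub>CI linear_mapsI)
    show "?p \<in> carrier M \<rightarrow>\<^sub>E carrier (restrict_module M K)"
      using closed ext by (auto simp: PiE_iff)
  next
    fix x x' assume x: "x \<in> carrier M" "x' \<in> carrier M"
    obtain y z where y: "y \<in> K" "z \<in> L" "x = y \<oplus>\<^bsub>M\<^esub> z"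
      using x(1) by (rule graded_decompositionE[OF D])
    obtain y' z' where y': "y' \<in> K" "z' \<in> L" "x' = y' \<oplus>\<^bsub>M\<^esub> z'"
      using x(2) by (rule graded_decompositionE[OF D])
    have "x \<oplus>\<^bsub>M\<^esub> x' = (y \<oplus>\<^bsub>M\<^esub> y') \<oplus>\<^bsub>M\<^esub> (z \<oplus>\<^bsub>M\<^esub> z')"
      using y y' by (simp add: M.a_ac Kc' Lc')
    then show "?p (x \<oplus>\<^bsub>M\<^esub> x') = ?p x \<oplus>\<^bsub>restrict_module M K\<^esub> ?p x'"
      using y y' by (simp add: projection_eq[OF D] Kc Lc)
  next
    fix a x assume a: "a \<in> carrier A" and x: "x \<in> carrier M"
    obtain y z where y: "y \<in> K" "z \<in> L" "x = y \<oplus>\<^bsub>M\<^esub> z"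
      using x by (rule graded_decompositionE[OF D])
    have "a \<odot>\<^bsub>M\<^esub> x = a \<odot>\<^bsub>M\<^esub> y \<oplus>\<^bsub>M\<^esub> a \<odot>\<^bsub>M\<^esub> z"
      using y a by (simp add: smult_r_distr Kc' Lc')
    then show "?p (a \<odot>\<^bsub>M\<^esub> x) = a \<odot>\<^bsub>restrict_module M K\<^esub> ?p x"
      using y a by (simp add: projection_eq[OF D] Kc Lc)
  next
    fix g x assume g: "g \<in> carrier G" and x: "x \<in> mcomp M g"
    have xM: "x \<in> carrier M" using x mcomp_subset[OF g] by auto
    then obtain y z where y: "y \<in> K" "z \<in> L" "x = y \<oplus>\<^bsub>M\<^esub> z"
      by (rule graded_decompositionE[OF D])
    obtain F where F: "finite F" "F \<subseteq> carrier G"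
      "\<And>H. \<lbrakk>finite H; F \<subseteq> H; H \<subseteq> carrier G\<rbrakk>
        \<Longrightarrow> \<exists>c. c \<in> Pi H (mcomp M) \<and> c \<in> H \<rightarrow> K \<and> y = finsum M c H"
      by (rule graded_submodule_components[OF K y(1)]) blast
    obtain F' where F': "finite F'" "F' \<subseteq> carrier G"
      "\<And>H. \<lbrakk>finite H; F' \<subseteq> H; H \<subseteq> carrier G\<rbrakk>
        \<Longrightarrow> \<exists>c. c \<in> Pi H (mcomp M) \<and> c \<in> H \<rightarrow> L \<and> z = finsum M c H"
      by (rule graded_submodule_components[OF L y(2)]) blast
    \<comment> \<open>A common set of degrees for y, z and x, hence the inclusion of g.\<close>
    define H where "H = insert g (F \<union> F')"
    have H: "finite H" "F \<subseteq> H" "F' \<subseteq> H" "H \<subseteq> carrier G" "g \<in> H"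
      using F(1,2) F'(1,2) g by (auto simp: H_def)
    obtain c where c: "c \<in> Pi H (mcomp M)" "c \<in> H \<rightarrow> K" "y = finsum M c H"
      using F(3) H by blast
    obtain d where d: "d \<in> Pi H (mcomp M)" "d \<in> H \<rightarrow> L" "z = finsum M d H"
      using F'(3) H by blast
    have cM: "c \<in> H \<rightarrow> carrier M" and dM: "d \<in> H \<rightarrow> carrier M"
      using c(2) d(2) Kc' Lc' by auto
    let ?x = "\<lambda>h. if g = h then x else \<zero>\<^bsub>M\<^esub>"
    have xH: "?x \<in> H \<rightarrow> carrier M" "?x \<in> Pi H (mcomp M)"
      using xM x H(4) mcomp_closed(1) by auto
    have fx: "finsum M ?x H = x"
      using M.finsum_singleton[OF H(5,1), of "\<lambda>_. x"] xM by simp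
    have cd: "(\<lambda>h. c h \<oplus>\<^bsub>M\<^esub> d h) \<in> H \<rightarrow> carrier M" using cM dM by auto
    \<comment> \<open>The degree h component of y + z minus that of x. These differences sum to
      zero, so each of them is zero.\<close>
    define r where "r = (\<lambda>h. (c h \<oplus>\<^bsub>M\<^esub> d h) \<ominus>\<^bsub>M\<^esub> ?x h)"
    have "x = (\<Oplus>\<^bsub>M\<^esub>h\<in>H. c h \<oplus>\<^bsub>M\<^esub> d h)"
      using M.finsum_addf[OF cM dM] y(3) c(3) d(3) by simp
    then have s: "finsum M r H = \<zero>\<^bsub>M\<^esub>"
      unfolding r_def using finsum_diff[OF M.abelian_group_axioms H(1) cd xH(1)] fx xM
      by (simp add: a_minus_def M.r_neg)
    have "r h \<in> mcomp M h" if "h \<in> H" for h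
      unfolding r_def a_minus_def
      using that c(1) d(1) xH(2) H(4) by (intro mcomp_closed(2,3)) (auto simp: Pi_iff subset_eq)
    then have e: "r h = \<zero>\<^bsub>M\<^esub>" if "h \<in> H" for h
      using that by (intro indep_mcomp[OF H(1,4) _ s]) auto
    have c0: "c h = \<zero>\<^bsub>M\<^esub>" if "h \<in> H" "h \<noteq> g" for h
    proof -
      have minus_zero: "\<ominus>\<^bsub>M\<^esub> \<zero>\<^bsub>M\<^esub> = \<zero>\<^bsub>M\<^esub>" by (rule M.minus_equality) auto
      have "c h \<oplus>\<^bsub>M\<^esub> d h = \<zero>\<^bsub>M\<^esub>"
        using e[OF that(1)] that cM dM by (simp add: r_def a_minus_def Pi_iff minus_zero)
      \<comment> \<open>Zero is projected in two ways: as an element of K, and as a sum of an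
        element of K and one of L.\<close>
      then have "?p (c h \<oplus>\<^bsub>M\<^esub> d h) = ?p (\<zero>\<^bsub>M\<^esub>)" by simp
      moreover have "?p (c h \<oplus>\<^bsub>M\<^esub> d h) = c h"
        using that c(2) d(2) by (intro projection_eq[OF D]) auto
      ultimately show ?thesis using pK[OF Kc(2)] by simp
    qed
    have "y = finsum M c {g}"
      unfolding c(3) using c0 cM H
      by (intro M.add.finprod_mono_neutral_cong_right) auto
    also have "\<dots> = c g" using cM H(5) by (simp add: M.finsum_insert Pi_iff)
    finally have "y = c g" .
    then have "y \<in> mcomp M g" using c(1) H(5) by auto
    then show "?p x \<in> mcomp (restrict_module M K) g"
      using projection_eq[OF D y(1,2)] y by simp
  qed
qed

text \<open>The splitting x = e x + (x - e x) into image and kernel. Both are graded because e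
  preserves degrees. The second claim says that the idempotent attached to this decomposition is e
  again, so every idempotent morphism arises as a \<open>summand_idempotent\<close>.\<close>

lemma idempotent_decomposition:
  assumes e: "e \<in> Mor\<^sub>C G A M M" and idem: "\<And>x. x \<in> carrier M \<Longrightarrow> e (e x) = e x"
  shows "graded_decomposition G A M (e ` carrier M) {x \<in> carrier M. e x = \<zero>\<^bsub>M\<^esub>}" (is "graded_decomposition G A M ?K ?L")
    and "summand_idempotent M (e ` carrier M) {x \<in> carrier M. e x = \<zero>\<^bsub>M\<^esub>} = e"
proof -
  note el = linear_mapsD[OF Mor\<^sub>CD(1)[OF e]]
  note neg = linear_maps_neg[OF Mor\<^sub>CD(1)[OF e] left_module_self]
  have e0: "e \<zero>\<^bsub>M\<^esub> = \<zero>\<^bsub>M\<^esub>"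
    by (rule linear_maps_zero[OF Mor\<^sub>CD(1)[OF e] left_module_self left_module_self])
  have fs: "e (finsum M c F) = (\<Oplus>\<^bsub>M\<^esub>i\<in>F. e (c i))" if "finite F" "c \<in> F \<rightarrow> carrier M" for c and F :: "'g set"
    by (rule linear_maps_finsum[OF Mor\<^sub>CD(1)[OF e] left_module_self left_module_self that])
  have ec: "e (c i) \<in> mcomp M i" if "c \<in> Pi F (mcomp M)" "F \<subseteq> carrier G" "i \<in> F" for c F i
    using Mor\<^sub>CD(2)[OF e, of i "c i"] that by auto
  have eK: "e y = y" if "y \<in> ?K" for y using that idem by auto
  have K: "graded_submodule G A ?K M"
  proof (rule graded_submoduleI)
    show "?K \<subseteq> carrier M" using el(3) by auto
    show "\<zero>\<^bsub>M\<^esub> \<in> ?K" using e0 by (metis M.zero_closed imageI)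
    show "x \<oplus>\<^bsub>M\<^esub> y \<in> ?K" if "x \<in> ?K" "y \<in> ?K" for x y
      using that el(4) M.a_closed by (metis (no_types, lifting) imageE imageI)
    show "\<ominus>\<^bsub>M\<^esub> x \<in> ?K" if "x \<in> ?K" for x
      using that neg by (metis (no_types, lifting) imageE imageI M.a_inv_closed)
    show "a \<odot>\<^bsub>M\<^esub> x \<in> ?K" if "a \<in> carrier A" "x \<in> ?K" for a x
      using that el(5) smult_closed by (metis (no_types, lifting) imageE imageI)
  next
    fix x assume x: "x \<in> ?K"
    then have "x \<in> carrier M" using el(3) by auto
    then obtain F c where F: "finite F" "F \<subseteq> carrier G" "c \<in> Pi F (mcomp M)" "c \<in> F \<rightarrow> carrier M"
      "x = finsum M c F" by (rule span_mcomp)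
    \<comment> \<open>As e fixes x, the components of x may be replaced by their images under e,
      which have the same degrees and lie in the image.\<close>
    have "x = (\<Oplus>\<^bsub>M\<^esub>i\<in>F. e (c i))"
      using fs[OF F(1,4)] eK[OF x] F(5) by simp
    moreover have "(\<lambda>i. e (c i)) \<in> Pi F (\<lambda>g. mcomp M g \<inter> ?K)"
      using ec[OF F(3,2)] F(4) by auto
    ultimately show "\<exists>F c. finite F \<and> F \<subseteq> carrier G \<and> c \<in> Pi F (\<lambda>g. mcomp M g \<inter> ?K) \<and> x = finsum M c F"
      using F(1,2) by blast
  qed
  have L: "graded_submodule G A ?L M"
  proof (rule graded_submoduleI)
    fix x assume "x \<in> ?L"
    then have x: "x \<in> carrier M" "e x = \<zero>\<^bsub>M\<^esub>" by auto
    from x(1) obtain F c where F: "finite F" "F \<subseteq> carrier G" "c \<in> Pi F (mcomp M)" "c \<in> F \<rightarrow> carrier M"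
      "x = finsum M c F" by (rule span_mcomp)
    \<comment> \<open>The images of the components are homogeneous of distinct degrees and sum to
      zero, so each component is itself in the kernel.\<close>
    have s: "(\<Oplus>\<^bsub>M\<^esub>i\<in>F. e (c i)) = \<zero>\<^bsub>M\<^esub>"
      using fs[OF F(1,4)] x(2) F(5) by simp
    have "e (c i) = \<zero>\<^bsub>M\<^esub>" if "i \<in> F" for i
      by (rule indep_mcomp[OF F(1,2) _ s that]) (use ec[OF F(3,2)] in auto)
    then have "c \<in> Pi F (\<lambda>g. mcomp M g \<inter> ?L)" using F(3,4) by auto
    then show "\<exists>F c. finite F \<and> F \<subseteq> carrier G \<and> c \<in> Pi F (\<lambda>g. mcomp M g \<inter> ?L) \<and> x = finsum M c F"
      using F(1,2,5) by blast
  qed (auto simp: e0 el neg smult_closed smult_zero)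
  have U: "\<exists>!(y, z). y \<in> ?K \<and> z \<in> ?L \<and> x = y \<oplus>\<^bsub>M\<^esub> z" if x: "x \<in> carrier M" for x
  proof (rule ex1I[of _ "(e x, x \<ominus>\<^bsub>M\<^esub> e x)"])
    have "e (x \<ominus>\<^bsub>M\<^esub> e x) = \<zero>\<^bsub>M\<^esub>"
      using x el(3) by (simp add: a_minus_def el(4) neg idem M.r_neg)
    moreover have "x = e x \<oplus>\<^bsub>M\<^esub> (x \<ominus>\<^bsub>M\<^esub> e x)"
      using x el(3) by (simp add: a_minus_def M.a_lcomm M.r_neg)
    ultimately show "case (e x, x \<ominus>\<^bsub>M\<^esub> e x) of (y, z) \<Rightarrow> y \<in> ?K \<and> z \<in> ?L \<and> x = y \<oplus>\<^bsub>M\<^esub> z"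
      using x el(3) by simp
  next
    fix p assume "case p of (y, z) \<Rightarrow> y \<in> ?K \<and> z \<in> ?L \<and> x = y \<oplus>\<^bsub>M\<^esub> z"
    then obtain y z where p: "p = (y, z)" "y \<in> ?K" "z \<in> carrier M" "e z = \<zero>\<^bsub>M\<^esub>" "x = y \<oplus>\<^bsub>M\<^esub> z"
      by auto
    have y: "y \<in> carrier M" using p(2) el(3) by auto
    \<comment> \<open>Applying e to y + z recovers y, since e fixes its image and kills z.\<close>
    have "e x = y" using p(4,5) el(4)[OF y p(3)] eK[OF p(2)] y by simp
    then show "p = (e x, x \<ominus>\<^bsub>M\<^esub> e x)"
      using p(1,3,5) y by (simp add: a_minus_def M.a_comm[of y z] M.a_assoc M.r_neg)
  qed
  show D: "graded_decomposition G A M ?K ?L"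
    unfolding graded_decomposition_def by (intro conjI ballI K L U)
  show "summand_idempotent M ?K ?L = e"
    unfolding projection_Mor\<^sub>C(3)[OF D]
  proof (rule extensionalityI[of _ "carrier M"])
    show "e \<in> extensional (carrier M)" by (rule el(2))
    fix x assume x: "x \<in> carrier M"
    have "e (x \<ominus>\<^bsub>M\<^esub> e x) = \<zero>\<^bsub>M\<^esub>"
      using x el(3) by (simp add: a_minus_def el(4) neg idem M.r_neg)
    then have "projection M ?K ?L (e x \<oplus>\<^bsub>M\<^esub> (x \<ominus>\<^bsub>M\<^esub> e x)) = e x"
      using x el(3) by (intro projection_eq[OF D]) auto
    moreover have "x = e x \<oplus>\<^bsub>M\<^esub> (x \<ominus>\<^bsub>M\<^esub> e x)"
      using x el(3) by (simp add: a_minus_def M.a_lcomm M.r_neg)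
    ultimately show "projection M ?K ?L x = e x" by simp
  qed (simp add: projection_def)
qed

end

section \<open>Semi-division as factorisation of an absorbing endomorphism\<close>

text \<open>The shape matches \<open>product_set\<close>, with products read as composites from N
  through M back to N. The case n = 0 is allowed and yields the zero map, which serves for degrees
  outside the support.\<close>

definition factors_through :: "('g, 'x) monoid_scheme \<Rightarrow> ('a, 'g, 'y) graded_ring_scheme
    \<Rightarrow> ('a, 'n, 'g, 'w) graded_module_scheme \<Rightarrow> ('a, 'm, 'g, 'z) graded_module_scheme
    \<Rightarrow> ('n \<Rightarrow> 'n) \<Rightarrow> bool"
  where "factors_through G A N M e \<longleftrightarrow> (\<exists>(n::nat) u v.
    u \<in> {..<n} \<rightarrow> Mor\<^sub>C G A N M \<and> v \<in> {..<n} \<rightarrow> Mor\<^sub>C G A M N \<and>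
    e = (\<lambda>x\<in>carrier N. \<Oplus>\<^bsub>N\<^esub>i\<in>{..<n}. v i (u i x)))"

context graded_left_module
begin

definition coordinate :: "nat \<Rightarrow> nat \<Rightarrow> (nat \<Rightarrow> 'm) \<Rightarrow> 'm"
  where "coordinate n i = (\<lambda>y\<in>carrier (power_module n M). y i)"

definition coinjection :: "nat \<Rightarrow> nat \<Rightarrow> 'm \<Rightarrow> nat \<Rightarrow> 'm"
  where "coinjection n i = (\<lambda>x\<in>carrier M. \<lambda>j\<in>{..<n}. if j = i then x else \<zero>\<^bsub>M\<^esub>)"

lemma coordinate_Mor\<^sub>C: "i < n \<Longrightarrow> coordinate n i \<in> Mor\<^sub>C G A (power_module n M) M"
proof (intro Mor\<^sub>CI linear_mapsI)
  fix g y assume "i < n" "g \<in> carrier G" "y \<in> mcomp (power_module n M) g"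
  moreover from this have "y \<in> carrier (power_module n M)"
    using graded_left_module.mcomp_subset[OF graded_left_module_power] by blast
  ultimately show "coordinate n i y \<in> mcomp M g"
    by (auto simp: coordinate_def PiE_iff simp del: power_module_simps(1))
qed (auto simp: coordinate_def PiE_iff smult_closed)

lemma coinjection_Mor\<^sub>C: "i < n \<Longrightarrow> coinjection n i \<in> Mor\<^sub>C G A M (power_module n M)"
proof (intro Mor\<^sub>CI linear_mapsI)
  fix g x assume "i < n" "g \<in> carrier G" "x \<in> mcomp M g"
  then show "coinjection n i x \<in> mcomp (power_module n M) g"
    using mcomp_subset mcomp_closed(1) by (auto simp: coinjection_def)
qed (auto simp: coinjection_def smult_closed smult_zero intro!: restrict_ext)

text \<open>The identity of the n-th power is the sum of the coinjections after the coordinates.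
  This splits a map that factors through the power into n maps that factor through M.\<close>

lemma finsum_coinjection:
  assumes y: "y \<in> carrier (power_module n M)"
  shows "y = (\<Oplus>\<^bsub>power_module n M\<^esub>i\<in>{..<n}. coinjection n i (y i))"
proof -
  have yi: "i < n \<Longrightarrow> y i \<in> carrier M" for i using y by auto
  have "(\<Oplus>\<^bsub>power_module n M\<^esub>i\<in>{..<n}. coinjection n i (y i)) =
      (\<lambda>j\<in>{..<n}. \<Oplus>\<^bsub>M\<^esub>i\<in>{..<n}. coinjection n i (y i) j)"
    using yi linear_mapsD(3)[OF Mor\<^sub>CD(1)[OF coinjection_Mor\<^sub>C]]
    by (intro finsum_power_module) (auto simp del: power_module_simps)
  also have "\<dots> = (\<lambda>j\<in>{..<n}. y j)"
  proof (rule restrict_ext)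
    fix j assume j: "j \<in> {..<n}"
    then have "(\<Oplus>\<^bsub>M\<^esub>i\<in>{..<n}. coinjection n i (y i) j) = (\<Oplus>\<^bsub>M\<^esub>i\<in>{..<n}. if j = i then y i else \<zero>\<^bsub>M\<^esub>)"
      using yi by (intro M.finsum_cong') (auto simp: coinjection_def)
    then show "(\<Oplus>\<^bsub>M\<^esub>i\<in>{..<n}. coinjection n i (y i) j) = y j"
      using M.finsum_singleton[OF j, of y] yi by auto
  qed
  also have "\<dots> = y" using y by (simp add: PiE_restrict)
  finally show ?thesis by simp
qed

text \<open>The endomorphism is the idempotent of N'. It factors through a power of M because N' is
  isomorphic to a summand of that power, and the coordinates of the power turn this into a sum of
  composites through M.\<close>

lemma semi_divides_imp_factors_through:
  assumes N: "graded_left_module G A N" and sd: "semi_divides G A N M"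
  obtains e where "factors_through G A N M e" "e \<noteq> (\<lambda>x\<in>carrier N. \<zero>\<^bsub>N\<^esub>)"
    "\<forall>f\<in>Mor\<^sub>C G A M N. compose (carrier M) e f = f"
    "\<forall>h\<in>Mor\<^sub>C G A N M. compose (carrier N) h e = h"
proof -
  interpret N: graded_left_module G A N by fact
  obtain N' L where D: "graded_decomposition G A N N' L" and "N' \<noteq> {\<zero>\<^bsub>N\<^esub>}"
    and dv: "divides\<^sub>C G A (restrict_module N N') M"
    and absorb: "\<forall>f\<in>Mor\<^sub>C G A M N. compose (carrier M) (summand_idempotent N N' L) f = f"
      "\<forall>h\<in>Mor\<^sub>C G A N M. compose (carrier N) h (summand_idempotent N N' L) = h"
    using sd unfolding semi_divides_def by blast
  obtain n K L' where D': "graded_decomposition G A (power_module n M) K L'"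
    and iso: "isomorphic\<^sub>C G A (restrict_module N N') (restrict_module (power_module n M) K)"
    using dv unfolding divides\<^sub>C_def by blast
  let ?P = "power_module n M"
  interpret P: graded_left_module G A ?P by (rule graded_left_module_power)
  obtain f h where f: "f \<in> Mor\<^sub>C G A (restrict_module N N') (restrict_module ?P K)"
    and h: "h \<in> Mor\<^sub>C G A (restrict_module ?P K) (restrict_module N N')"
    and hf: "compose N' h f = (\<lambda>x\<in>N'. x)"
    using iso unfolding isomorphic\<^sub>C_def by auto
  have sub: "N' \<subseteq> carrier N" "K \<subseteq> carrier ?P" and zero: "\<zero>\<^bsub>N\<^esub> \<in> N'"
    using D D' N.graded_submodule_closed P.graded_submodule_closed
    by (auto simp: graded_decomposition_def)
  let ?p = "projection N N' L" and ?q = "projection ?P K L'"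
  note p = N.projection_Mor\<^sub>C[OF D] and q = P.projection_Mor\<^sub>C[OF D']
  \<comment> \<open>The map u projects N to N' and embeds N' into the power; v projects the power to
    the copy K of N' and returns to N. Their composite is the projection onto N'.\<close>
  define u where "u = compose (carrier N) f ?p"
  define v where "v = compose (carrier ?P) h ?q"
  have u: "u \<in> Mor\<^sub>C G A N ?P"
    unfolding u_def by (rule Mor\<^sub>C_into_restrict[OF N.Mor\<^sub>C_compose[OF p(1) f] sub(2)])
  have v: "v \<in> Mor\<^sub>C G A ?P N"
    unfolding v_def by (rule Mor\<^sub>C_into_restrict[OF P.Mor\<^sub>C_compose[OF q(1) h] sub(1)])
  have vu: "v (u x) = ?p x" if x: "x \<in> carrier N" for x
  proof -
    have px: "?p x \<in> N'" using linear_mapsD(3)[OF Mor\<^sub>CD(1)[OF p(1)] x] by simp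
    then have fK: "f (?p x) \<in> K" using linear_mapsD(3)[OF Mor\<^sub>CD(1)[OF f]] by simp
    have "v (u x) = h (f (?p x))"
      using x q(2)[OF fK] fK sub(2) unfolding u_def v_def compose_def by auto
    also have "\<dots> = ?p x"
      using fun_cong[OF hf, of "?p x"] px by (simp add: compose_def)
    finally show ?thesis .
  qed
  \<comment> \<open>The i-th coordinate of u and the restriction of v to the i-th factor of the
    power.\<close>
  define u' where "u' i = compose (carrier N) (coordinate n i) u" for i
  define v' where "v' i = compose (carrier M) v (coinjection n i)" for i
  have u': "u' \<in> {..<n} \<rightarrow> Mor\<^sub>C G A N M"
    unfolding u'_def using N.Mor\<^sub>C_compose[OF u coordinate_Mor\<^sub>C] by auto
  have v': "v' \<in> {..<n} \<rightarrow> Mor\<^sub>C G A M N"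
    unfolding v'_def using Mor\<^sub>C_compose[OF coinjection_Mor\<^sub>C v] by auto
  have "(\<Oplus>\<^bsub>N\<^esub>i\<in>{..<n}. v' i (u' i x)) = ?p x" if x: "x \<in> carrier N" for x
  proof -
    have ux: "u x \<in> carrier ?P" using linear_mapsD(3)[OF Mor\<^sub>CD(1)[OF u] x] .
    then have uxi: "u x i \<in> carrier M" if "i < n" for i using that by auto
    have d: "coinjection n i (u x i) \<in> carrier ?P" if "i < n" for i
      using linear_mapsD(3)[OF Mor\<^sub>CD(1)[OF coinjection_Mor\<^sub>C[OF that]] uxi[OF that]] .
    have "v (u x) = v (\<Oplus>\<^bsub>?P\<^esub>i\<in>{..<n}. coinjection n i (u x i))"
      using finsum_coinjection[OF ux] by simp
    also have "\<dots> = (\<Oplus>\<^bsub>N\<^esub>i\<in>{..<n}. v (coinjection n i (u x i)))"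
      by (rule linear_maps_finsum[OF Mor\<^sub>CD(1)[OF v] P.left_module_self N.left_module_self])
        (use d in auto)
    also have "\<dots> = (\<Oplus>\<^bsub>N\<^esub>i\<in>{..<n}. v' i (u' i x))"
    proof (rule N.M.finsum_cong'[OF refl])
      show "(\<lambda>i. v' i (u' i x)) \<in> {..<n} \<rightarrow> carrier N"
      proof
        fix i assume i: "i \<in> {..<n}"
        show "v' i (u' i x) \<in> carrier N"
          using linear_mapsD(3)[OF Mor\<^sub>CD(1)[OF Pi_mem[OF u' i]] x]
          by (rule linear_mapsD(3)[OF Mor\<^sub>CD(1)[OF Pi_mem[OF v' i]]])
      qed
      fix i assume "i \<in> {..<n}"
      then show "v (coinjection n i (u x i)) = v' i (u' i x)"
        using x ux uxi by (simp add: u'_def v'_def compose_def coordinate_def del: power_module_simps)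
    qed
    finally show ?thesis using vu[OF x] by simp
  qed
  then have e: "summand_idempotent N N' L = (\<lambda>x\<in>carrier N. \<Oplus>\<^bsub>N\<^esub>i\<in>{..<n}. v' i (u' i x))"
    unfolding p(3) by (intro extensionalityI[of _ "carrier N"]) (auto simp: projection_def)
  \<comment> \<open>The projection fixes N' pointwise, so it vanishes only if N' does.\<close>
  have "summand_idempotent N N' L \<noteq> (\<lambda>x\<in>carrier N. \<zero>\<^bsub>N\<^esub>)"
  proof
    assume *: "summand_idempotent N N' L = (\<lambda>x\<in>carrier N. \<zero>\<^bsub>N\<^esub>)"
    have "y = \<zero>\<^bsub>N\<^esub>" if "y \<in> N'" for y
      using fun_cong[OF *[unfolded p(3)], of y] p(2)[OF that] that sub(1) by auto
    then show False using zero \<open>N' \<noteq> {\<zero>\<^bsub>N\<^esub>}\<close> by blast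
  qed
  moreover have "factors_through G A N M (summand_idempotent N N' L)"
    unfolding factors_through_def using u' v' e by blast
  ultimately show ?thesis using that absorb by blast
qed

text \<open>Collect the u_i into a map a from N to the power and the v_i into a map b back, so that
  e = b a. Since e absorbs every u_i and v_i, one has a e = a and e b = b. Hence e = b a and q = a b
  are both idempotent, and a and b restrict to mutually inverse isomorphisms between their
  images.\<close>

lemma factors_through_imp_semi_divides:
  assumes N: "graded_left_module G A N"
    and e: "factors_through G A N M e" "e \<noteq> (\<lambda>x\<in>carrier N. \<zero>\<^bsub>N\<^esub>)"
    and absorb: "\<forall>f\<in>Mor\<^sub>C G A M N. compose (carrier M) e f = f"
      "\<forall>h\<in>Mor\<^sub>C G A N M. compose (carrier N) h e = h"
  shows "semi_divides G A N M"
proof -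
  interpret N: graded_left_module G A N by fact
  obtain n u v where u: "u \<in> {..<n} \<rightarrow> Mor\<^sub>C G A N M" and v: "v \<in> {..<n} \<rightarrow> Mor\<^sub>C G A M N"
    and e_eq: "e = (\<lambda>x\<in>carrier N. \<Oplus>\<^bsub>N\<^esub>i\<in>{..<n::nat}. v i (u i x))"
    using e(1) unfolding factors_through_def by blast
  let ?P = "power_module n M"
  interpret P: graded_left_module G A ?P by (rule graded_left_module_power)
  have ui: "u i \<in> Mor\<^sub>C G A N M" and vi: "v i \<in> Mor\<^sub>C G A M N" if "i < n" for i
    using u v that by auto
  note ul = linear_mapsD[OF Mor\<^sub>CD(1)[OF ui]] and vl = linear_mapsD[OF Mor\<^sub>CD(1)[OF vi]]
  \<comment> \<open>Here a has the coordinates u_i, and b is the sum of the v_i applied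
    coordinatewise.\<close>
  define a where "a = (\<lambda>x\<in>carrier N. \<lambda>i\<in>{..<n}. u i x)"
  define b where "b = (\<lambda>y\<in>carrier ?P. \<Oplus>\<^bsub>N\<^esub>i\<in>{..<n}. v i (y i))"
  have a: "a \<in> Mor\<^sub>C G A N ?P"
  proof (intro Mor\<^sub>CI linear_mapsI)
    fix g x assume "g \<in> carrier G" "x \<in> mcomp N g"
    then show "a x \<in> mcomp ?P g"
      using N.mcomp_subset Mor\<^sub>CD(2)[OF ui] by (auto simp: a_def)
  qed (auto simp: a_def ul N.smult_closed intro!: restrict_ext)
  have b: "b \<in> Mor\<^sub>C G A ?P N"
  proof (intro Mor\<^sub>CI linear_mapsI)
    have yi: "y i \<in> carrier M" if "y \<in> carrier ?P" "i < n" for y i using that by auto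
    show "b \<in> carrier ?P \<rightarrow>\<^sub>E carrier N"
      unfolding b_def using yi vl(3) by (auto intro!: N.M.finsum_closed simp del: power_module_simps)
    show "b (y \<oplus>\<^bsub>?P\<^esub> y') = b y \<oplus>\<^bsub>N\<^esub> b y'" if y: "y \<in> carrier ?P" "y' \<in> carrier ?P" for y y'
    proof -
      have "b (y \<oplus>\<^bsub>?P\<^esub> y') = (\<Oplus>\<^bsub>N\<^esub>i\<in>{..<n}. v i ((y \<oplus>\<^bsub>?P\<^esub> y') i))"
        using P.M.a_closed[OF y] by (simp add: b_def del: power_module_simps)
      also have "\<dots> = (\<Oplus>\<^bsub>N\<^esub>i\<in>{..<n}. v i (y i) \<oplus>\<^bsub>N\<^esub> v i (y' i))"
        using yi[OF y(1)] yi[OF y(2)] vl(3,4) by (intro N.M.finsum_cong') auto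
      also have "\<dots> = b y \<oplus>\<^bsub>N\<^esub> b y'"
        using y yi[OF y(1)] yi[OF y(2)] vl(3)
        by (subst N.M.finsum_addf) (auto simp: b_def simp del: power_module_simps)
      finally show ?thesis .
    qed
    show "b (r \<odot>\<^bsub>?P\<^esub> y) = r \<odot>\<^bsub>N\<^esub> b y" if r: "r \<in> carrier A" and y: "y \<in> carrier ?P" for r y
    proof -
      have "b (r \<odot>\<^bsub>?P\<^esub> y) = (\<Oplus>\<^bsub>N\<^esub>i\<in>{..<n}. v i ((r \<odot>\<^bsub>?P\<^esub> y) i))"
        using P.smult_closed[OF r y] by (simp add: b_def del: power_module_simps)
      also have "\<dots> = (\<Oplus>\<^bsub>N\<^esub>i\<in>{..<n}. r \<odot>\<^bsub>N\<^esub> v i (y i))"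
        using r yi[OF y] vl(3,5) N.smult_closed by (intro N.M.finsum_cong') auto
      also have "\<dots> = r \<odot>\<^bsub>N\<^esub> (\<Oplus>\<^bsub>N\<^esub>i\<in>{..<n}. v i (y i))"
        by (rule additive_map_finsum[OF N.M.abelian_group_axioms N.M.abelian_group_axioms, symmetric])
          (use r yi[OF y] vl(3) in \<open>auto simp: N.smult_closed N.smult_r_distr\<close>)
      also have "\<dots> = r \<odot>\<^bsub>N\<^esub> b y" using y by (simp add: b_def del: power_module_simps)
      finally show ?thesis .
    qed
    show "b y \<in> mcomp N g" if g: "g \<in> carrier G" and y: "y \<in> mcomp ?P g" for g y
    proof -
      have "y \<in> carrier ?P" using y P.mcomp_subset[OF g] by blast
      moreover have "(\<lambda>i. v i (y i)) \<in> {..<n} \<rightarrow> mcomp N g"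
        using y Mor\<^sub>CD(2)[OF vi g] by auto
      ultimately show ?thesis
        using N.finsum_mcomp[OF g, of "{..<n}"] by (simp add: b_def del: power_module_simps)
    qed
  qed
  note al = linear_mapsD[OF Mor\<^sub>CD(1)[OF a]] and bl = linear_mapsD[OF Mor\<^sub>CD(1)[OF b]]
  have ba: "b (a x) = e x" if x: "x \<in> carrier N" for x
  proof -
    have "b (a x) = (\<Oplus>\<^bsub>N\<^esub>i\<in>{..<n}. v i (a x i))"
      using al(3)[OF x] by (simp add: b_def del: power_module_simps)
    also have "\<dots> = (\<Oplus>\<^bsub>N\<^esub>i\<in>{..<n}. v i (u i x))"
      using x ul(3) vl(3) by (intro N.M.finsum_cong') (auto simp: a_def)
    finally show ?thesis using x by (simp add: e_eq)
  qed
  have e_comp: "e = compose (carrier N) b a"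
    using ba by (intro extensionalityI[of _ "carrier N"]) (auto simp: e_eq compose_def)
  have eM: "e \<in> Mor\<^sub>C G A N N"
    unfolding e_comp by (rule N.Mor\<^sub>C_compose[OF a b])
  note el = linear_mapsD[OF Mor\<^sub>CD(1)[OF eM]]
  \<comment> \<open>Absorption is applied to the morphisms u_i and v_i from the factorisation of e
    itself.\<close>
  have ue: "u i (e x) = u i x" if "i < n" "x \<in> carrier N" for i x
    using absorb(2) ui[OF that(1)] that(2) by (metis compose_eq)
  have ev: "e (v i y) = v i y" if "i < n" "y \<in> carrier M" for i y
    using absorb(1) vi[OF that(1)] that(2) by (metis compose_eq)
  have ae: "a (e x) = a x" if "x \<in> carrier N" for x
    using that ue el(3) by (auto simp: a_def intro!: restrict_ext)
  have eb: "e (b y) = b y" if y: "y \<in> carrier ?P" for y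
  proof -
    have yi: "y i \<in> carrier M" if "i < n" for i using that y by auto
    have "e (b y) = (\<Oplus>\<^bsub>N\<^esub>i\<in>{..<n}. e (v i (y i)))"
      using y linear_maps_finsum[OF Mor\<^sub>CD(1)[OF eM] N.left_module_self N.left_module_self, of "{..<n}" "\<lambda>i. v i (y i)"]
        vl(3) yi by (simp add: b_def Pi_iff del: power_module_simps)
    also have "\<dots> = (\<Oplus>\<^bsub>N\<^esub>i\<in>{..<n}. v i (y i))"
      using ev yi vl(3) by (intro N.M.finsum_cong') auto
    finally show ?thesis using y by (simp add: b_def del: power_module_simps)
  qed
  \<comment> \<open>Idempotence follows from e e = e (b a) = (e b) a = b a = e.\<close>
  have ee: "e (e x) = e x" if x: "x \<in> carrier N" for x
    using eb[OF al(3)[OF x]] ba[OF x] by simp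
  \<comment> \<open>The companion idempotent on the power; its image is the summand to which the
    image of e is isomorphic.\<close>
  define q where "q = compose (carrier ?P) a b"
  have q: "q \<in> Mor\<^sub>C G A ?P ?P" unfolding q_def by (rule P.Mor\<^sub>C_compose[OF b a])
  have qy: "q y = a (b y)" if "y \<in> carrier ?P" for y
    using that by (simp add: q_def compose_def del: power_module_simps)
  note ql = linear_mapsD[OF Mor\<^sub>CD(1)[OF q]]
  have qa: "q (a x) = a x" if x: "x \<in> carrier N" for x
    using qy[OF al(3)[OF x]] ba[OF x] ae[OF x] by simp
  have qq: "q (q y) = q y" if y: "y \<in> carrier ?P" for y
    using qa[OF bl(3)[OF y]] qy[OF y] by simp
  note D = N.idempotent_decomposition[OF eM ee] and D' = P.idempotent_decomposition[OF q qq]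
  let ?N' = "e ` carrier N" and ?K = "q ` carrier ?P"
  have sub: "?N' \<subseteq> carrier N" "?K \<subseteq> carrier ?P" using el(3) ql(3) by blast+
  \<comment> \<open>\<open>divides\<^sub>C\<close> asks for a positive power; an empty sum would
    make e zero.\<close>
  have "n \<ge> 1"
  proof (rule ccontr)
    assume "\<not> n \<ge> 1"
    then have "n = 0" by simp
    then have "e = (\<lambda>x\<in>carrier N. \<zero>\<^bsub>N\<^esub>)" by (simp add: e_eq)
    then show False using e(2) by contradiction
  qed
  moreover have "isomorphic\<^sub>C G A (restrict_module N ?N') (restrict_module ?P ?K)"
    unfolding isomorphic\<^sub>C_def
  proof (intro bexI conjI)
    \<comment> \<open>On the image of e the composite b a is e, hence the identity; on the image of
      q the composite a b is q, hence the identity.\<close>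
    let ?f = "restrict a ?N'" and ?h = "restrict b ?K"
    have aK: "a x \<in> ?K" if "x \<in> carrier N" for x
      using qa[OF that] al(3)[OF that] by (metis imageI)
    have bN': "b y \<in> ?N'" if "y \<in> carrier ?P" for y
      using eb[OF that] bl(3)[OF that] by (metis imageI)
    have N'D: "x \<in> carrier N" "e x = x" if "x \<in> ?N'" for x using that el(3) ee by auto
    have KD: "y \<in> carrier ?P" "q y = y" if "y \<in> ?K" for y using that ql(3) qq by auto
    have "graded_submodule G A ?N' N" "graded_submodule G A ?K ?P"
      using D(1) D'(1) by (simp_all only: graded_decomposition_def)
    note N'c = N.graded_submodule_closed(3,4)[OF this(1)] and Kc = P.graded_submodule_closed(3,4)[OF this(2)]
    show "?f \<in> Mor\<^sub>C G A (restrict_module N ?N') (restrict_module ?P ?K)"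
      using aK N'D(1) N'c al(4,5) Mor\<^sub>CD(2)[OF a]
      by (intro Mor\<^sub>CI linear_mapsI) (simp_all del: power_module_simps)
    show "?h \<in> Mor\<^sub>C G A (restrict_module ?P ?K) (restrict_module N ?N')"
      using bN' KD(1) Kc bl(4,5) Mor\<^sub>CD(2)[OF b]
      by (intro Mor\<^sub>CI linear_mapsI) (simp_all del: power_module_simps)
    have "?h (?f x) = x" if x: "x \<in> ?N'" for x
      using x aK[OF N'D(1)[OF x]] ba[OF N'D(1)[OF x]] N'D(2)[OF x] by simp
    then show "compose (carrier (restrict_module N ?N')) ?h ?f = (\<lambda>x\<in>carrier (restrict_module N ?N'). x)"
      unfolding compose_def restrict_module_simps by (intro restrict_ext)
    have "?f (?h y) = y" if y: "y \<in> ?K" for y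
      using y bN'[OF KD(1)[OF y]] qy[OF KD(1)[OF y]] KD(2)[OF y] by simp
    then show "compose (carrier (restrict_module ?P ?K)) ?f ?h = (\<lambda>x\<in>carrier (restrict_module ?P ?K). x)"
      unfolding compose_def restrict_module_simps by (intro restrict_ext)
  qed
  ultimately have dv: "divides\<^sub>C G A (restrict_module N ?N') M"
    unfolding divides\<^sub>C_def using D'(1) by blast
  have "?N' \<noteq> {\<zero>\<^bsub>N\<^esub>}"
  proof
    assume "?N' = {\<zero>\<^bsub>N\<^esub>}"
    then have "e x = \<zero>\<^bsub>N\<^esub>" if "x \<in> carrier N" for x using that by blast
    then have "e = (\<lambda>x\<in>carrier N. \<zero>\<^bsub>N\<^esub>)"
      using el(2) by (intro extensionalityI[of _ "carrier N"]) auto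
    then show False using e(2) by contradiction
  qed
  then show ?thesis
    unfolding semi_divides_def using D dv absorb
    by (intro exI[of _ ?N'] exI[of _ "{x \<in> carrier N. e x = \<zero>\<^bsub>N\<^esub>}"]) simp
qed

end

section \<open>The graded endomorphism ring\<close>

lemma END_simps [simp]:
  "mult (END G A M) u v = compose (carrier M) v u" "\<one>\<^bsub>END G A M\<^esub> = (\<lambda>x\<in>carrier M. x)"
  "\<zero>\<^bsub>END G A M\<^esub> = (\<lambda>x\<in>carrier M. \<zero>\<^bsub>M\<^esub>)"
  "u \<oplus>\<^bsub>END G A M\<^esub> v = (\<lambda>x\<in>carrier M. u x \<oplus>\<^bsub>M\<^esub> v x)"
  "rcomp (END G A M) = Mor_deg G A M M"
  by (simp_all add: END_def)

context graded_left_module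
begin

lemma smult_minus: "\<lbrakk>a \<in> carrier A; x \<in> carrier M\<rbrakk> \<Longrightarrow> \<ominus>\<^bsub>M\<^esub> (a \<odot>\<^bsub>M\<^esub> x) = a \<odot>\<^bsub>M\<^esub> (\<ominus>\<^bsub>M\<^esub> x)"
  using smult_r_distr[of a "\<ominus>\<^bsub>M\<^esub> x" x] by (intro M.minus_equality) (auto simp: M.l_neg smult_zero smult_closed)

lemma Mor_degI:
  assumes "f \<in> linear_maps A M M"
    "\<And>g x. \<lbrakk>g \<in> carrier G; x \<in> mcomp M g\<rbrakk> \<Longrightarrow> f x \<in> mcomp M (g \<otimes>\<^bsub>G\<^esub> l)"
  shows "f \<in> Mor_deg G A M M l"
  using assms unfolding Mor_deg_def by auto

lemma Mor_degD:
  assumes "f \<in> Mor_deg G A M M l"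
  shows "f \<in> linear_maps A M M"
    "\<lbrakk>g \<in> carrier G; x \<in> mcomp M g\<rbrakk> \<Longrightarrow> f x \<in> mcomp M (g \<otimes>\<^bsub>G\<^esub> l)"
  using assms unfolding Mor_deg_def by auto

text \<open>The ring of all A-linear endomorphisms with the operations of \<open>END\<close>. Its
  ring axioms can be checked pointwise, after which \<open>END\<close> is obtained as a
  subring.\<close>

abbreviation "linear_END \<equiv> END G A M\<lparr>carrier := linear_maps A M M\<rparr>"

lemma linear_maps_add:
  assumes "u \<in> linear_maps A M M" "v \<in> linear_maps A M M"
  shows "(\<lambda>x\<in>carrier M. u x \<oplus>\<^bsub>M\<^esub> v x) \<in> linear_maps A M M"
  using linear_mapsD[OF assms(1)] linear_mapsD[OF assms(2)]
  by (intro linear_mapsI) (auto simp: smult_closed smult_r_distr M.a_ac)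

lemma linear_maps_minus:
  assumes "u \<in> linear_maps A M M"
  shows "(\<lambda>x\<in>carrier M. \<ominus>\<^bsub>M\<^esub> u x) \<in> linear_maps A M M"
  using linear_mapsD[OF assms]
  by (intro linear_mapsI) (auto simp: smult_closed smult_minus M.minus_add)

text \<open>The inner abstraction stays unreduced, since this is how the pointwise negative appears
  when substituted into the addition of \<open>END\<close>.\<close>

lemma linear_maps_l_neg:
  assumes "u \<in> linear_maps A M M"
  shows "(\<lambda>x\<in>carrier M. (\<lambda>x\<in>carrier M. \<ominus>\<^bsub>M\<^esub> u x) x \<oplus>\<^bsub>M\<^esub> u x) = (\<lambda>x\<in>carrier M. \<zero>\<^bsub>M\<^esub>)"
  by (rule restrict_ext) (simp add: M.l_neg linear_mapsD(3)[OF assms])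

lemma linear_maps_zero_map: "(\<lambda>x\<in>carrier M. \<zero>\<^bsub>M\<^esub>) \<in> linear_maps A M M"
  by (intro linear_mapsI) (auto simp: smult_closed smult_zero)

lemma linear_maps_id: "(\<lambda>x\<in>carrier M. x) \<in> linear_maps A M M"
  by (intro linear_mapsI) (auto simp: smult_closed)

lemma ring_linear_END: "ring linear_END"
proof (rule ringI)
  show "abelian_group linear_END"
  proof (rule abelian_groupI)
    fix u assume u: "u \<in> carrier linear_END"
    show "\<exists>v\<in>carrier linear_END. v \<oplus>\<^bsub>linear_END\<^esub> u = \<zero>\<^bsub>linear_END\<^esub>"
      using u by (intro bexI[of _ "\<lambda>x\<in>carrier M. \<ominus>\<^bsub>M\<^esub> u x"])
        (simp_all add: linear_maps_minus linear_maps_l_neg del: restrict_apply)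
    show "\<zero>\<^bsub>linear_END\<^esub> \<oplus>\<^bsub>linear_END\<^esub> u = u"
      using u linear_mapsD(2,3)[of u A M M]
      by (intro extensionalityI[of _ "carrier M"]) auto
  qed (auto simp: linear_maps_add linear_maps_zero_map linear_mapsD(3) M.a_ac intro!: restrict_ext)
  show "monoid linear_END"
  proof (rule monoidI)
    fix u assume u: "u \<in> carrier linear_END"
    show "\<one>\<^bsub>linear_END\<^esub> \<otimes>\<^bsub>linear_END\<^esub> u = u" "u \<otimes>\<^bsub>linear_END\<^esub> \<one>\<^bsub>linear_END\<^esub> = u"
      using u linear_mapsD(1,2)[of u A M M] by (simp_all add: compose_Id Id_compose)
  next
    fix u v w assume "u \<in> carrier linear_END" "v \<in> carrier linear_END" "w \<in> carrier linear_END"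
    then show "u \<otimes>\<^bsub>linear_END\<^esub> v \<otimes>\<^bsub>linear_END\<^esub> w = u \<otimes>\<^bsub>linear_END\<^esub> (v \<otimes>\<^bsub>linear_END\<^esub> w)"
      using linear_mapsD(1)[of u A M M] by (simp add: compose_assoc)
  qed (simp_all add: linear_maps_compose linear_maps_id)
qed (auto simp: compose_def linear_mapsD(3,4) intro!: restrict_ext)

lemma finsum_linear_END:
  assumes "finite F" "u \<in> F \<rightarrow> linear_maps A M M"
  shows "finsum linear_END u F = (\<lambda>x\<in>carrier M. \<Oplus>\<^bsub>M\<^esub>i\<in>F. u i x)"
proof -
  interpret E: ring linear_END by (rule ring_linear_END)
  show ?thesis
    using assms
  proof (induction F)
    case empty
    then show ?case by simp
  next
    case (insert j F)
    have u: "u \<in> F \<rightarrow> carrier linear_END" "u j \<in> carrier linear_END"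
      using insert.prems by auto
    have "(\<lambda>i. u i x) \<in> F \<rightarrow> carrier M" "u j x \<in> carrier M" if "x \<in> carrier M" for x
      using u linear_mapsD(3)[OF _ that] by (auto simp: Pi_iff)
    then show ?case
      unfolding E.finsum_insert[OF insert.hyps u]
      using insert.IH u insert.hyps by (auto simp: M.finsum_insert intro!: restrict_ext)
  qed
qed

lemma Mor_deg_linear: "Mor_deg G A M M l \<subseteq> linear_maps A M M"
  by (auto simp: Mor_deg_def)

text \<open>Replaces the pointwise sums by sums in a ring, so that distributivity and the other laws
  for \<open>finsum\<close> become available.\<close>

lemma carrier_END: "carrier (END G A M) =
  {f. \<exists>F u. finite F \<and> F \<subseteq> carrier G \<and> u \<in> Pi F (Mor_deg G A M M) \<and> f = finsum linear_END u F}"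
proof -
  have eq: "(\<lambda>x\<in>carrier M. \<Oplus>\<^bsub>M\<^esub>l\<in>F. u l x) = finsum linear_END u F"
    if "finite F" "u \<in> Pi F (Mor_deg G A M M)" for F and u :: "'g \<Rightarrow> 'm \<Rightarrow> 'm"
    using that Mor_deg_linear by (intro finsum_linear_END[symmetric]) auto
  have "carrier (END G A M) = {f. \<exists>F u. finite F \<and> F \<subseteq> carrier G \<and> u \<in> Pi F (Mor_deg G A M M) \<and>
      f = (\<lambda>x\<in>carrier M. \<Oplus>\<^bsub>M\<^esub>l\<in>F. u l x)}"
    by (simp add: END_def)
  also have "\<dots> = {f. \<exists>F u. finite F \<and> F \<subseteq> carrier G \<and> u \<in> Pi F (Mor_deg G A M M) \<and>
      f = finsum linear_END u F}"
    by (intro Collect_cong ex_cong1 conj_cong refl) (simp only: eq)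
  finally show ?thesis .
qed

lemma Mor_deg_closed:
  assumes l: "l \<in> carrier G"
  shows "(\<lambda>x\<in>carrier M. \<zero>\<^bsub>M\<^esub>) \<in> Mor_deg G A M M l"
    "\<lbrakk>u \<in> Mor_deg G A M M l; v \<in> Mor_deg G A M M l\<rbrakk>
      \<Longrightarrow> (\<lambda>x\<in>carrier M. u x \<oplus>\<^bsub>M\<^esub> v x) \<in> Mor_deg G A M M l"
    "u \<in> Mor_deg G A M M l \<Longrightarrow> (\<lambda>x\<in>carrier M. \<ominus>\<^bsub>M\<^esub> u x) \<in> Mor_deg G A M M l"
proof -
  have gl: "g \<otimes>\<^bsub>G\<^esub> l \<in> carrier G" if "g \<in> carrier G" for g using that l by simp
  have xM: "x \<in> carrier M" if "g \<in> carrier G" "x \<in> mcomp M g" for g x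
    using that mcomp_subset by auto
  show "(\<lambda>x\<in>carrier M. \<zero>\<^bsub>M\<^esub>) \<in> Mor_deg G A M M l"
    by (intro Mor_degI linear_maps_zero_map) (use xM mcomp_closed(1)[OF gl] in auto)
  show "(\<lambda>x\<in>carrier M. u x \<oplus>\<^bsub>M\<^esub> v x) \<in> Mor_deg G A M M l"
    if u: "u \<in> Mor_deg G A M M l" and v: "v \<in> Mor_deg G A M M l"
    by (intro Mor_degI linear_maps_add Mor_degD(1)[OF u] Mor_degD(1)[OF v])
      (use xM mcomp_closed(2)[OF gl] Mor_degD(2)[OF u] Mor_degD(2)[OF v] in auto)
  show "(\<lambda>x\<in>carrier M. \<ominus>\<^bsub>M\<^esub> u x) \<in> Mor_deg G A M M l"
    if u: "u \<in> Mor_deg G A M M l"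
    by (intro Mor_degI linear_maps_minus Mor_degD(1)[OF u])
      (use xM mcomp_closed(3)[OF gl] Mor_degD(2)[OF u] in auto)
qed

text \<open>The reversed product fits the right translation of degrees: applying u first and v
  second sends degree g to g l and then to g l k.\<close>

lemma Mor_deg_compose:
  assumes "l \<in> carrier G" "k \<in> carrier G" "u \<in> Mor_deg G A M M l" "v \<in> Mor_deg G A M M k"
  shows "compose (carrier M) v u \<in> Mor_deg G A M M (l \<otimes>\<^bsub>G\<^esub> k)"
proof (intro Mor_degI linear_maps_compose[OF Mor_degD(1)[OF assms(3)] Mor_degD(1)[OF assms(4)]])
  fix g x assume g: "g \<in> carrier G" and x: "x \<in> mcomp M g"
  then have "v (u x) \<in> mcomp M ((g \<otimes>\<^bsub>G\<^esub> l) \<otimes>\<^bsub>G\<^esub> k)"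
    using assms(1) Mor_degD(2)[OF assms(3) g x] by (intro Mor_degD(2)[OF assms(4)]) auto
  then show "compose (carrier M) v u x \<in> mcomp M (g \<otimes>\<^bsub>G\<^esub> (l \<otimes>\<^bsub>G\<^esub> k))"
    using g x assms(1,2) mcomp_subset[OF g] by (auto simp: compose_def grade_assoc)
qed

lemma Mor_deg_id: "(\<lambda>x\<in>carrier M. x) \<in> Mor_deg G A M M \<one>\<^bsub>G\<^esub>"
proof (intro Mor_degI linear_maps_id)
  fix g x assume g: "g \<in> carrier G" and x: "x \<in> mcomp M g"
  have "g \<otimes>\<^bsub>G\<^esub> \<one>\<^bsub>G\<^esub> = g" using g group_G by (simp add: group.is_monoid monoid.r_one)
  then show "(\<lambda>x\<in>carrier M. x) x \<in> mcomp M (g \<otimes>\<^bsub>G\<^esub> \<one>\<^bsub>G\<^esub>)"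
    using g x mcomp_subset[OF g] by auto
qed

text \<open>Sums are handled by padding both families to a common set of degrees, and products by
  expanding both factors into homogeneous products, each of which is homogeneous again.\<close>

lemma subring_END: "subring (carrier (END G A M)) linear_END"
proof -
  interpret E: ring linear_END by (rule ring_linear_END)
  let ?S = "carrier (END G A M)"
  have deg: "f \<in> carrier linear_END" if "f \<in> Mor_deg G A M M l" for f l
    using that Mor_deg_linear by auto
  have degE: "u \<in> F \<rightarrow> carrier linear_END" if "u \<in> Pi F (Mor_deg G A M M)" for u F
    using that deg by blast
  have SE: "\<exists>F u. finite F \<and> F \<subseteq> carrier G \<and> u \<in> Pi F (Mor_deg G A M M) \<and> f = finsum linear_END u F"
    if "f \<in> ?S" for f
    using that unfolding carrier_END by blast
  have SI: "finsum linear_END u F \<in> ?S" if "finite F" "F \<subseteq> carrier G" "u \<in> Pi F (Mor_deg G A M M)"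
    for F u
    using that unfolding carrier_END by blast
  have MS: "f \<in> ?S" if "l \<in> carrier G" "f \<in> Mor_deg G A M M l" for f l
    using SI[of "{l}" "\<lambda>_. f"] that E.finsum_single[OF deg[OF that(2)], of l] by simp
  have SL: "?S \<subseteq> carrier linear_END"
  proof
    fix f assume "f \<in> ?S"
    then obtain F u where "u \<in> Pi F (Mor_deg G A M M)" "f = finsum linear_END u F" using SE by blast
    then show "f \<in> carrier linear_END" using E.finsum_closed[OF degE] by blast
  qed
  have add: "f \<oplus>\<^bsub>linear_END\<^esub> h \<in> ?S" if f: "f \<in> ?S" and h: "h \<in> ?S" for f h
  proof -
    obtain F u where F: "finite F" "F \<subseteq> carrier G" "u \<in> Pi F (Mor_deg G A M M)"
      "f = finsum linear_END u F" using SE[OF f] by blast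
    obtain H w where H: "finite H" "H \<subseteq> carrier G" "w \<in> Pi H (Mor_deg G A M M)"
      "h = finsum linear_END w H" using SE[OF h] by blast
    \<comment> \<open>Both families are extended by zero to the union of their index sets, so that
      they can be added degree by degree.\<close>
    let ?u = "\<lambda>i. if i \<in> F then u i else \<zero>\<^bsub>linear_END\<^esub>"
      and ?w = "\<lambda>i. if i \<in> H then w i else \<zero>\<^bsub>linear_END\<^esub>"
    have u: "?u \<in> F \<union> H \<rightarrow> carrier linear_END" and w: "?w \<in> F \<union> H \<rightarrow> carrier linear_END"
      using degE[OF F(3)] degE[OF H(3)] E.zero_closed by (auto simp del: END_simps)
    have "f = finsum linear_END ?u (F \<union> H)"
      unfolding F(4) by (rule E.add.finprod_mono_neutral_cong_left) (use F(1) H(1) u in auto)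
    moreover have "h = finsum linear_END ?w (F \<union> H)"
      unfolding H(4) by (rule E.add.finprod_mono_neutral_cong_left) (use F(1) H(1) w in auto)
    ultimately have eq: "f \<oplus>\<^bsub>linear_END\<^esub> h = (\<Oplus>\<^bsub>linear_END\<^esub>i\<in>F \<union> H. ?u i \<oplus>\<^bsub>linear_END\<^esub> ?w i)"
      using E.finsum_addf[OF u w] by (simp only:)
    have "?u i \<oplus>\<^bsub>linear_END\<^esub> ?w i \<in> Mor_deg G A M M i" if "i \<in> F \<union> H" for i
    proof -
      have iG: "i \<in> carrier G" using that F(2) H(2) by blast
      have "?u i \<in> Mor_deg G A M M i" "?w i \<in> Mor_deg G A M M i"
        using F(3) H(3) Mor_deg_closed(1)[OF iG] by (simp_all add: Pi_iff)
      then show ?thesis using Mor_deg_closed(2)[OF iG] by simp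
    qed
    then have "(\<lambda>i. ?u i \<oplus>\<^bsub>linear_END\<^esub> ?w i) \<in> Pi (F \<union> H) (Mor_deg G A M M)"
      by (rule Pi_I)
    then show ?thesis
      unfolding eq using F(1,2) H(1,2) by (intro SI finite_UnI Un_least)
  qed
  \<comment> \<open>Needed for products: after expansion, terms indexed by l are homogeneous of
    varying degree, so only membership in the carrier can be tracked.\<close>
  have sum: "finsum linear_END f F \<in> ?S" if "finite F" "f \<in> F \<rightarrow> ?S" for F and f :: "'g \<Rightarrow> 'm \<Rightarrow> 'm"
    using that
  proof (induction F)
    case empty
    show ?case
      using SI[of "{}" f] by (simp only: E.finsum_empty finite.emptyI empty_subsetI Pi_empty UNIV_I)
  next
    case (insert i F)
    then have f: "f \<in> F \<rightarrow> carrier linear_END" "f i \<in> carrier linear_END" using SL by auto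
    show ?case
      unfolding E.finsum_insert[OF insert.hyps f] using insert by (intro add) auto
  qed
  show ?thesis
  proof (rule E.subringI)
    show "?S \<subseteq> carrier linear_END" by (rule SL)
    show "\<one>\<^bsub>linear_END\<^esub> \<in> ?S" using MS[OF _ Mor_deg_id] by simp
    show "h1 \<oplus>\<^bsub>linear_END\<^esub> h2 \<in> ?S" if "h1 \<in> ?S" "h2 \<in> ?S" for h1 h2
      using that by (rule add)
  next
    fix f assume "f \<in> ?S"
    then obtain F u where F: "finite F" "F \<subseteq> carrier G" "u \<in> Pi F (Mor_deg G A M M)"
      "f = finsum linear_END u F" using SE by blast
    \<comment> \<open>Uniqueness of inverses identifies the ring negative with the pointwise one,
      which visibly keeps the degree.\<close>
    have neg: "\<ominus>\<^bsub>linear_END\<^esub> w = (\<lambda>x\<in>carrier M. \<ominus>\<^bsub>M\<^esub> w x)" if "w \<in> linear_maps A M M" for w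
      by (rule E.minus_equality) (use that linear_maps_l_neg[OF that] linear_maps_minus[OF that] in simp_all)
    have "\<ominus>\<^bsub>linear_END\<^esub> f = (\<Oplus>\<^bsub>linear_END\<^esub>i\<in>F. \<ominus>\<^bsub>linear_END\<^esub> u i)"
      unfolding F(4)
      by (rule additive_map_finsum[OF E.abelian_group_axioms E.abelian_group_axioms _ _ F(1) degE[OF F(3)]])
        (use E.minus_add E.a_comm E.a_inv_closed in \<open>auto simp del: END_simps\<close>)
    moreover have "\<ominus>\<^bsub>linear_END\<^esub> u i \<in> Mor_deg G A M M i" if "i \<in> F" for i
      using Mor_deg_closed(3)[of i "u i"] neg[of "u i"] F(2,3) that Mor_deg_linear by (auto simp: Pi_iff subset_eq)
    ultimately show "\<ominus>\<^bsub>linear_END\<^esub> f \<in> ?S"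
      using SI[OF F(1,2)] by auto
  next
    fix f h assume "f \<in> ?S" "h \<in> ?S"
    obtain F u where F: "finite F" "F \<subseteq> carrier G" "u \<in> Pi F (Mor_deg G A M M)"
      "f = finsum linear_END u F" using SE[OF \<open>f \<in> ?S\<close>] by blast
    obtain H w where H: "finite H" "H \<subseteq> carrier G" "w \<in> Pi H (Mor_deg G A M M)"
      "h = finsum linear_END w H" using SE[OF \<open>h \<in> ?S\<close>] by blast
    have hE: "h \<in> carrier linear_END" using SL \<open>h \<in> ?S\<close> by blast
    \<comment> \<open>A product of homogeneous maps of degrees l and k is homogeneous of degree l
      k.\<close>
    have prod: "u l \<otimes>\<^bsub>linear_END\<^esub> w k \<in> ?S" if "l \<in> F" "k \<in> H" for l k
      using Mor_deg_compose[of l k "u l" "w k"] MS[of "l \<otimes>\<^bsub>G\<^esub> k"] that F(2,3) H(2,3)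
      by (auto simp: Pi_iff subset_eq)
    have "f \<otimes>\<^bsub>linear_END\<^esub> h = (\<Oplus>\<^bsub>linear_END\<^esub>l\<in>F. u l \<otimes>\<^bsub>linear_END\<^esub> h)"
      unfolding F(4) by (rule E.finsum_ldistr[OF F(1) hE degE[OF F(3)]])
    moreover have "u l \<otimes>\<^bsub>linear_END\<^esub> h \<in> ?S" if l: "l \<in> F" for l
    proof -
      have ul: "u l \<in> carrier linear_END" using degE[OF F(3)] l by blast
      have "u l \<otimes>\<^bsub>linear_END\<^esub> h = (\<Oplus>\<^bsub>linear_END\<^esub>k\<in>H. u l \<otimes>\<^bsub>linear_END\<^esub> w k)"
        unfolding H(4) by (rule E.finsum_rdistr[OF H(1) ul degE[OF H(3)]])
      then show ?thesis using sum[OF H(1), of "\<lambda>k. u l \<otimes>\<^bsub>linear_END\<^esub> w k"] prod[OF l] by auto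
    qed
    ultimately show "f \<otimes>\<^bsub>linear_END\<^esub> h \<in> ?S"
      using sum[OF F(1), of "\<lambda>l. u l \<otimes>\<^bsub>linear_END\<^esub> h"] by auto
  qed
qed

lemma ring_END: "ring (END G A M)"
proof -
  have "linear_END\<lparr>carrier := carrier (END G A M)\<rparr> = END G A M" by (simp add: END_def)
  then show ?thesis using ring.subring_is_ring[OF ring_linear_END subring_END] by (simp only:)
qed

lemma finsum_END_eq:
  assumes "c \<in> F \<rightarrow> carrier (END G A M)"
  shows "finsum (END G A M) c F = finsum linear_END c F"
proof (rule finsum_agree[OF _ _ _ _ _ assms])
  show "carrier (END G A M) \<subseteq> carrier linear_END" by (rule subringE(1)[OF subring_END])
  show "abelian_monoid linear_END" "abelian_monoid (END G A M)"
    using ring.is_abelian_group[OF ring_linear_END] ring.is_abelian_group[OF ring_END]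
    by (auto simp: abelian_group_def)
qed (simp_all add: END_def)

lemma Mor_deg_subset_END:
  assumes "l \<in> carrier G"
  shows "Mor_deg G A M M l \<subseteq> carrier (END G A M)"
proof
  fix f assume f: "f \<in> Mor_deg G A M M l"
  interpret E: ring linear_END by (rule ring_linear_END)
  have "f \<in> carrier linear_END" using f Mor_deg_linear by auto
  then have "f = finsum linear_END (\<lambda>_. f) {l}" by (rule E.finsum_single[symmetric])
  then show "f \<in> carrier (END G A M)"
    unfolding carrier_END using f assms
    by (intro CollectI exI[of _ "{l}"] exI[of _ "\<lambda>_. f"] conjI) simp_all
qed

text \<open>For independence, a vanishing sum of maps c_i of degree i is evaluated at x of degree g.
  The values c_i x lie in the distinct degrees g i, so each is zero, and a linear map that kills all
  homogeneous elements is zero.\<close>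

lemma graded_ring_END: "graded_ring G (END G A M)"
proof -
  interpret B: ring "END G A M" by (rule ring_END)
  have sub: "c \<in> F \<rightarrow> carrier (END G A M)" if "c \<in> Pi F (Mor_deg G A M M)" "F \<subseteq> carrier G" for c F
    using that Mor_deg_subset_END by blast
  have "internal_direct_sum (END G A M) (carrier G) (rcomp (END G A M))"
  proof (rule internal_direct_sumI[OF B.abelian_group_axioms])
    fix l assume l: "l \<in> carrier G"
    have "\<exists>v\<in>Mor_deg G A M M l. (\<lambda>x\<in>carrier M. v x \<oplus>\<^bsub>M\<^esub> u x) = (\<lambda>x\<in>carrier M. \<zero>\<^bsub>M\<^esub>)"
      if u: "u \<in> Mor_deg G A M M l" for u
      by (intro bexI[of _ "\<lambda>x\<in>carrier M. \<ominus>\<^bsub>M\<^esub> u x"] linear_maps_l_neg Mor_degD(1)[OF u]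
          Mor_deg_closed(3)[OF l u])
    then show "additive_subgroup (rcomp (END G A M) l) (END G A M)"
      using Mor_deg_subset_END[OF l] Mor_deg_closed(1,2)[OF l]
      by (simp add: additive_subgroup_iff[OF B.abelian_group_axioms])
  next
    fix f assume "f \<in> carrier (END G A M)"
    then obtain F u where F: "finite F" "F \<subseteq> carrier G" "u \<in> Pi F (Mor_deg G A M M)"
      "f = finsum linear_END u F" unfolding carrier_END by blast
    then show "\<exists>F c. finite F \<and> F \<subseteq> carrier G \<and> c \<in> Pi F (rcomp (END G A M)) \<and> f = finsum (END G A M) c F"
      using finsum_END_eq[OF sub[OF F(3,2)]] by (intro exI[of _ F] exI[of _ u]) simp
  next
    fix F c l assume F: "finite F" "F \<subseteq> carrier G" "c \<in> Pi F (rcomp (END G A M))"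
      "finsum (END G A M) c F = \<zero>\<^bsub>END G A M\<^esub>" "l \<in> F"
    have c: "c i \<in> Mor_deg G A M M i" if "i \<in> F" for i using F(3) that by auto
    have "finsum linear_END c F = (\<lambda>x\<in>carrier M. \<zero>\<^bsub>M\<^esub>)"
      using F(2,3,4) finsum_END_eq[OF sub, of c F] by simp
    then have s: "(\<lambda>x\<in>carrier M. \<Oplus>\<^bsub>M\<^esub>i\<in>F. c i x) = (\<lambda>x\<in>carrier M. \<zero>\<^bsub>M\<^esub>)"
      using finsum_linear_END[OF F(1), of c] Mor_degD(1)[OF c] by simp
    have "c l = (\<lambda>x\<in>carrier M. \<zero>\<^bsub>M\<^esub>)"
    proof (rule linear_maps_cong_mcomp[OF left_module_self Mor_degD(1)[OF c[OF F(5)]] linear_maps_zero_map])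
      fix g x assume g: "g \<in> carrier G" and x: "x \<in> mcomp M g"
      have xM: "x \<in> carrier M" using x mcomp_subset[OF g] by blast
      have "(\<Oplus>\<^bsub>M\<^esub>i\<in>F. c i x) = \<zero>\<^bsub>M\<^esub>" using fun_cong[OF s, of x] xM by simp
      then have "c l x = \<zero>\<^bsub>M\<^esub>"
        \<comment> \<open>Left translation by g is the injective reindexing of degrees.\<close>
        using Mor_degD(2)[OF c g x] F(1,2,5) g
        by (intro internal_direct_sum_indep_reindex[OF M.abelian_group_axioms module_direct_sum,
              where \<phi> = "\<lambda>i. g \<otimes>\<^bsub>G\<^esub> i" and F = F and c = "\<lambda>i. c i x"])
          (auto simp: inj_on_def subset_eq)
      then show "c l x = (\<lambda>x\<in>carrier M. \<zero>\<^bsub>M\<^esub>) x" using xM by simp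
    qed
    then show "c l = \<zero>\<^bsub>END G A M\<^esub>" by simp
  qed
  then show ?thesis
    using Mor_deg_compose group_G B.ring_axioms
    by (intro graded_ring.intro graded_ring_axioms.intro) auto
qed

section \<open>Translation between shifts and degrees\<close>

lemma Mor\<^sub>C_shift: "Mor\<^sub>C G A M (shift G M l) = Mor_deg G A M M l"
  by (simp add: Mor\<^sub>C_def Mor_deg_def linear_maps_def)

text \<open>Substituting g l^{-1} for g turns the condition that degree g l goes to degree g into
  the condition that degree g goes to g l^{-1}; substituting g l reverses this.\<close>

lemma Mor\<^sub>C_from_shift:
  assumes l: "l \<in> carrier G"
  shows "Mor\<^sub>C G A (shift G M l) M = Mor_deg G A M M (inv\<^bsub>G\<^esub> l)"
proof -
  have "(\<forall>g\<in>carrier G. f ` mcomp M (g \<otimes>\<^bsub>G\<^esub> l) \<subseteq> mcomp M g) \<longleftrightarrow>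
    (\<forall>g\<in>carrier G. f ` mcomp M g \<subseteq> mcomp M (g \<otimes>\<^bsub>G\<^esub> inv\<^bsub>G\<^esub> l))" (is "?P \<longleftrightarrow> ?Q") for f :: "'m \<Rightarrow> 'm"
  proof
    assume P: ?P
    show ?Q
    proof
      fix g assume g: "g \<in> carrier G"
      then show "f ` mcomp M g \<subseteq> mcomp M (g \<otimes>\<^bsub>G\<^esub> inv\<^bsub>G\<^esub> l)"
        using P[rule_format, of "g \<otimes>\<^bsub>G\<^esub> inv\<^bsub>G\<^esub> l"] l by (simp add: grade_assoc)
    qed
  next
    assume Q: ?Q
    show ?P
    proof
      fix g assume g: "g \<in> carrier G"
      then show "f ` mcomp M (g \<otimes>\<^bsub>G\<^esub> l) \<subseteq> mcomp M g"
        using Q[rule_format, of "g \<otimes>\<^bsub>G\<^esub> l"] l by (simp add: grade_assoc)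
    qed
  qed
  then show ?thesis by (simp add: Mor\<^sub>C_def Mor_deg_def linear_maps_def)
qed

lemma finsum_shift:
  assumes "l \<in> carrier G" "c \<in> F \<rightarrow> carrier M"
  shows "finsum (shift G M l) c F = finsum M c F"
proof -
  interpret S: graded_left_module G A "shift G M l" using assms(1) by (rule graded_left_module_shift)
  show ?thesis
    using assms(2) by (intro finsum_agree M.abelian_monoid_axioms S.M.abelian_monoid_axioms) auto
qed

text \<open>Both sides speak of the same maps: first degree l^{-1}, then degree l. Only the record
  in which the sum is formed differs.\<close>

lemma factors_through_from_shift:
  assumes l: "l \<in> carrier G"
  shows "factors_through G A (shift G M l) M e \<longleftrightarrow> factors_through G A M (shift G M (inv\<^bsub>G\<^esub> l)) e"
proof -
  have "(\<lambda>x\<in>carrier M. \<Oplus>\<^bsub>shift G M l\<^esub>i\<in>{..<n}. v i (u i x)) = (\<lambda>x\<in>carrier M. \<Oplus>\<^bsub>M\<^esub>i\<in>{..<n}. v i (u i x))"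
    if "u \<in> {..<n} \<rightarrow> Mor_deg G A M M (inv\<^bsub>G\<^esub> l)" "v \<in> {..<n} \<rightarrow> Mor_deg G A M M l" for n :: nat and u v
  proof (intro restrict_ext finsum_shift[OF l])
    fix x assume x: "x \<in> carrier M"
    show "(\<lambda>i. v i (u i x)) \<in> {..<n} \<rightarrow> carrier M"
    proof
      fix i assume i: "i \<in> {..<n}"
      show "v i (u i x) \<in> carrier M"
        using linear_mapsD(3)[OF Mor_degD(1)[OF Pi_mem[OF that(1) i]] x]
        by (rule linear_mapsD(3)[OF Mor_degD(1)[OF Pi_mem[OF that(2) i]]])
    qed
  qed
  then show ?thesis
    using l unfolding factors_through_def
    by (simp add: Mor\<^sub>C_shift Mor\<^sub>C_from_shift cong: conj_cong)
qed

text \<open>Both sides describe sums of v_i after u_i with u_i of degree l and v_i of degree l^{-1};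
  the reversed product writes this composite as u_i v_i.\<close>

lemma product_set_END:
  assumes l: "l \<in> carrier G"
  shows "e \<in> product_set (END G A M) (Mor_deg G A M M l) (Mor_deg G A M M (inv\<^bsub>G\<^esub> l)) \<longleftrightarrow>
    factors_through G A M (shift G M l) e"
proof -
  have "(\<Oplus>\<^bsub>END G A M\<^esub>i\<in>{..<n}. u i \<otimes>\<^bsub>END G A M\<^esub> v i) = (\<lambda>x\<in>carrier M. \<Oplus>\<^bsub>M\<^esub>i\<in>{..<n}. v i (u i x))"
    if u: "u \<in> {..<n} \<rightarrow> Mor_deg G A M M l" and v: "v \<in> {..<n} \<rightarrow> Mor_deg G A M M (inv\<^bsub>G\<^esub> l)"
    for n :: nat and u v
  proof -
    have lin: "u i \<in> linear_maps A M M" "v i \<in> linear_maps A M M" if "i < n" for i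
      using u v Mor_deg_linear that by auto
    have "u i \<otimes>\<^bsub>END G A M\<^esub> v i \<in> carrier (END G A M)" if "i < n" for i
    proof -
      have "u i \<otimes>\<^bsub>END G A M\<^esub> v i \<in> Mor_deg G A M M (l \<otimes>\<^bsub>G\<^esub> inv\<^bsub>G\<^esub> l)"
        using Mor_deg_compose[OF l _ Pi_mem[OF u] Pi_mem[OF v], of i i] l that by simp
      then show ?thesis using Mor_deg_subset_END[of "l \<otimes>\<^bsub>G\<^esub> inv\<^bsub>G\<^esub> l"] l by auto
    qed
    then have "(\<Oplus>\<^bsub>END G A M\<^esub>i\<in>{..<n}. u i \<otimes>\<^bsub>END G A M\<^esub> v i) = (\<Oplus>\<^bsub>linear_END\<^esub>i\<in>{..<n}. u i \<otimes>\<^bsub>END G A M\<^esub> v i)"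
      by (intro finsum_END_eq) auto
    also have "\<dots> = (\<lambda>x\<in>carrier M. \<Oplus>\<^bsub>M\<^esub>i\<in>{..<n}. (u i \<otimes>\<^bsub>END G A M\<^esub> v i) x)"
      using linear_maps_compose[OF lin] by (intro finsum_linear_END) auto
    also have "\<dots> = (\<lambda>x\<in>carrier M. \<Oplus>\<^bsub>M\<^esub>i\<in>{..<n}. v i (u i x))"
      by (intro restrict_ext M.finsum_cong')
        (use linear_mapsD(3)[OF lin(1)] linear_mapsD(3)[OF lin(2)] in \<open>auto simp: compose_def\<close>)
    finally show ?thesis .
  qed
  then show ?thesis
    unfolding product_set_def factors_through_def Mor\<^sub>C_shift Mor\<^sub>C_from_shift[OF l] mem_Collect_eq
    by (intro ex_cong1) (auto simp del: END_simps)
qed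

section \<open>Epsilon-strong grading and semi-equivalence of shifts\<close>

lemma zero_compose: "b \<in> linear_maps A M M \<Longrightarrow> compose (carrier M) b (\<lambda>x\<in>carrier M. \<zero>\<^bsub>M\<^esub>) = (\<lambda>x\<in>carrier M. \<zero>\<^bsub>M\<^esub>)"
  using linear_maps_zero[OF _ left_module_self left_module_self] by (auto simp: compose_def intro!: restrict_ext)

lemma compose_zero: "b \<in> linear_maps A M M \<Longrightarrow> compose (carrier M) (\<lambda>x\<in>carrier M. \<zero>\<^bsub>M\<^esub>) b = (\<lambda>x\<in>carrier M. \<zero>\<^bsub>M\<^esub>)"
  using linear_mapsD(3)[of b A M M] by (auto simp: compose_def intro!: restrict_ext)

text \<open>Read as a finite sum in the ring \<open>linear_END\<close>, the map e stays in its
  carrier.\<close>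

lemma factors_through_linear:
  assumes "l \<in> carrier G" "factors_through G A M (shift G M l) e"
  shows "e \<in> linear_maps A M M"
proof -
  interpret E: ring linear_END by (rule ring_linear_END)
  obtain n u v where uv: "u \<in> {..<n::nat} \<rightarrow> Mor_deg G A M M l"
    "v \<in> {..<n} \<rightarrow> Mor_deg G A M M (inv\<^bsub>G\<^esub> l)"
    and e: "e = (\<lambda>x\<in>carrier M. \<Oplus>\<^bsub>M\<^esub>i\<in>{..<n}. v i (u i x))"
    using assms(2) unfolding factors_through_def Mor\<^sub>C_shift Mor\<^sub>C_from_shift[OF assms(1)] by blast
  have w: "(\<lambda>i. compose (carrier M) (v i) (u i)) \<in> {..<n} \<rightarrow> linear_maps A M M"
    using linear_maps_compose[OF Mor_degD(1)[OF Pi_mem[OF uv(1)]] Mor_degD(1)[OF Pi_mem[OF uv(2)]]] by blast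
  have "finsum linear_END (\<lambda>i. compose (carrier M) (v i) (u i)) {..<n} = e"
    unfolding finsum_linear_END[OF finite_lessThan w] e by (intro restrict_ext) (simp add: compose_eq)
  moreover have "finsum linear_END (\<lambda>i. compose (carrier M) (v i) (u i)) {..<n} \<in> carrier linear_END"
    using w by (intro E.finsum_closed) simp
  ultimately show ?thesis by simp
qed

lemma supp_END: "l \<in> supp G (END G A M) \<longleftrightarrow>
    l \<in> carrier G \<and> (\<exists>b\<in>Mor_deg G A M M l. b \<noteq> (\<lambda>x\<in>carrier M. \<zero>\<^bsub>M\<^esub>))"
  using Mor_deg_closed(1) unfolding supp_def by auto

text \<open>The element \<epsilon> at l witnesses that M semi-divides its shift by l, and \<epsilon>
  at l^{-1} that the shift semi-divides M. In each case one absorption condition is a left unit law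
  and the other a right unit law at the inverse degree.\<close>

lemma epsilon_imp_semi_equivalent:
  assumes eps: "epsilon_strongly_graded_ring G (END G A M)" and l: "l \<in> supp G (END G A M)"
  shows "semi_equivalent G A M (shift G M l)"
proof -
  let ?z = "\<lambda>x\<in>carrier M. \<zero>\<^bsub>M\<^esub>"
  obtain \<epsilon> where \<epsilon>: "\<forall>g\<in>carrier G.
      \<epsilon> g \<in> product_set (END G A M) (Mor_deg G A M M g) (Mor_deg G A M M (inv\<^bsub>G\<^esub> g)) \<and>
      (\<forall>b\<in>Mor_deg G A M M g. compose (carrier M) b (\<epsilon> g) = b \<and> b = compose (carrier M) (\<epsilon> (inv\<^bsub>G\<^esub> g)) b)"
    using epsilon_strongly_graded_ring.epsilon[OF eps] by auto
  have prod: "\<epsilon> g \<in> product_set (END G A M) (Mor_deg G A M M g) (Mor_deg G A M M (inv\<^bsub>G\<^esub> g))"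
    if "g \<in> carrier G" for g
    using \<epsilon> that by blast
  \<comment> \<open>Left and right refer to the ring product, so the left unit law has \<epsilon>
    applied before b.\<close>
  have left: "compose (carrier M) b (\<epsilon> g) = b" and right: "compose (carrier M) (\<epsilon> (inv\<^bsub>G\<^esub> g)) b = b"
    if "g \<in> carrier G" "b \<in> Mor_deg G A M M g" for g b
    using bspec[OF conjunct2[OF bspec[OF \<epsilon> that(1)]] that(2)] by (simp_all only:)
  obtain b where lG: "l \<in> carrier G" and b: "b \<in> Mor_deg G A M M l" "b \<noteq> ?z"
    using l unfolding supp_END by blast
  have iG: "inv\<^bsub>G\<^esub> l \<in> carrier G" and ii: "inv\<^bsub>G\<^esub> (inv\<^bsub>G\<^esub> l) = l"
    using lG group.inv_closed[OF group_G] group.inv_inv[OF group_G] by auto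
  \<comment> \<open>A unit acting on the non-zero element b cannot be zero. The same b serves for
    both degrees: \<epsilon> at l acts on it from the left, \<epsilon> at l^{-1} from the
    right.\<close>
  have nz: "\<epsilon> l \<noteq> ?z" using left[OF lG b(1)] zero_compose[OF Mor_degD(1)[OF b(1)]] b(2) by auto
  have nz': "\<epsilon> (inv\<^bsub>G\<^esub> l) \<noteq> ?z"
    using right[OF lG b(1)] compose_zero[OF Mor_degD(1)[OF b(1)]] b(2) by auto
  note S = graded_left_module_shift[OF lG]
  have e: "factors_through G A M (shift G M l) (\<epsilon> l)"
    using prod[OF lG] product_set_END[OF lG] by blast
  have e': "factors_through G A (shift G M l) M (\<epsilon> (inv\<^bsub>G\<^esub> l))"
    using prod[OF iG] product_set_END[OF iG] factors_through_from_shift[OF lG] by blast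
  have "semi_divides G A (shift G M l) M"
  proof (rule factors_through_imp_semi_divides[OF S e'])
    show "\<epsilon> (inv\<^bsub>G\<^esub> l) \<noteq> (\<lambda>x\<in>carrier (shift G M l). \<zero>\<^bsub>shift G M l\<^esub>)" using nz' by simp
    show "\<forall>f\<in>Mor\<^sub>C G A M (shift G M l). compose (carrier M) (\<epsilon> (inv\<^bsub>G\<^esub> l)) f = f"
      using right[OF lG] by (simp add: Mor\<^sub>C_shift)
    show "\<forall>h\<in>Mor\<^sub>C G A (shift G M l) M. compose (carrier (shift G M l)) h (\<epsilon> (inv\<^bsub>G\<^esub> l)) = h"
      using left[OF iG] by (simp add: Mor\<^sub>C_from_shift[OF lG])
  qed
  moreover have "semi_divides G A M (shift G M l)"
  proof (rule graded_left_module.factors_through_imp_semi_divides[OF S graded_left_module_axioms e nz])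
    show "\<forall>f\<in>Mor\<^sub>C G A (shift G M l) M. compose (carrier (shift G M l)) (\<epsilon> l) f = f"
      using right[OF iG] ii by (simp add: Mor\<^sub>C_from_shift[OF lG])
    show "\<forall>h\<in>Mor\<^sub>C G A M (shift G M l). compose (carrier M) h (\<epsilon> l) = h"
      using left[OF lG] by (simp add: Mor\<^sub>C_shift)
  qed
  ultimately show ?thesis by (simp add: semi_equivalent_def)
qed

text \<open>The hypothesis at l provides a left unit for degree l that is at the same time a right
  unit for degree l^{-1}. The right unit for degree l therefore comes from the hypothesis at l^{-1},
  which applies because the support is closed under inverses.\<close>

lemma semi_divides_shift_imp_epsilon:
  assumes sd: "\<And>l. l \<in> supp G (END G A M) \<Longrightarrow> semi_divides G A M (shift G M l)"
  shows "epsilon_strongly_graded_ring G (END G A M)"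
proof -
  let ?z = "\<lambda>x\<in>carrier M. \<zero>\<^bsub>M\<^esub>"
  let ?B = "END G A M"
  \<comment> \<open>The witness of semi-division with its absorption conditions rewritten in terms
    of degrees.\<close>
  let ?E = "\<lambda>l e. factors_through G A M (shift G M l) e \<and> e \<noteq> ?z \<and>
      (\<forall>f\<in>Mor_deg G A M M (inv\<^bsub>G\<^esub> l). compose (carrier M) e f = f) \<and>
      (\<forall>h\<in>Mor_deg G A M M l. compose (carrier M) h e = h)"
  have "\<exists>e. ?E l e" if l: "l \<in> supp G ?B" for l
  proof -
    have lG: "l \<in> carrier G" using l by (simp add: supp_def)
    obtain e where "factors_through G A M (shift G M l) e" "e \<noteq> ?z"
      "\<forall>f\<in>Mor\<^sub>C G A (shift G M l) M. compose (carrier (shift G M l)) e f = f"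
      "\<forall>h\<in>Mor\<^sub>C G A M (shift G M l). compose (carrier M) h e = h"
      using graded_left_module.semi_divides_imp_factors_through[OF
          graded_left_module_shift[OF lG] graded_left_module_axioms sd[OF l]] by blast
    then show ?thesis by (auto simp: Mor\<^sub>C_shift Mor\<^sub>C_from_shift[OF lG])
  qed
  then obtain e where "\<forall>l\<in>supp G ?B. ?E l (e l)"
    using bchoice[of "supp G ?B" ?E] by blast
  then have e: "\<And>l. l \<in> supp G ?B \<Longrightarrow> factors_through G A M (shift G M l) (e l)"
    "\<And>l. l \<in> supp G ?B \<Longrightarrow> e l \<noteq> ?z"
    "\<And>l f. \<lbrakk>l \<in> supp G ?B; f \<in> Mor_deg G A M M (inv\<^bsub>G\<^esub> l)\<rbrakk> \<Longrightarrow> compose (carrier M) (e l) f = f"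
    "\<And>l h. \<lbrakk>l \<in> supp G ?B; h \<in> Mor_deg G A M M l\<rbrakk> \<Longrightarrow> compose (carrier M) h (e l) = h"
    by blast+
  \<comment> \<open>Outside the support zero is the only element to be fixed, so zero can serve as
    the unit.\<close>
  define \<epsilon> where "\<epsilon> l = (if l \<in> supp G ?B then e l else ?z)" for l
  have sym: "inv\<^bsub>G\<^esub> l \<in> supp G ?B" if l: "l \<in> supp G ?B" for l
  proof (rule ccontr)
    assume n: "inv\<^bsub>G\<^esub> l \<notin> supp G ?B"
    have lG: "l \<in> carrier G" using l by (simp add: supp_def)
    then have iG: "inv\<^bsub>G\<^esub> l \<in> carrier G" using group.inv_closed[OF group_G] by simp
    obtain n u v where uv: "u \<in> {..<n::nat} \<rightarrow> Mor_deg G A M M l"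
      "v \<in> {..<n} \<rightarrow> Mor_deg G A M M (inv\<^bsub>G\<^esub> l)"
      and el: "e l = (\<lambda>x\<in>carrier M. \<Oplus>\<^bsub>M\<^esub>i\<in>{..<n}. v i (u i x))"
      using e(1)[OF l] unfolding factors_through_def Mor\<^sub>C_shift Mor\<^sub>C_from_shift[OF lG] by blast
    \<comment> \<open>If degree l^{-1} were outside the support, all second factors v_i would be
      zero and so would e l.\<close>
    have vz: "v i = ?z" if "i \<in> {..<n}" for i
      using Pi_mem[OF uv(2) that] n iG unfolding supp_END by blast
    have "(\<Oplus>\<^bsub>M\<^esub>i\<in>{..<n}. v i (u i x)) = \<zero>\<^bsub>M\<^esub>" if x: "x \<in> carrier M" for x
    proof -
      have "(\<Oplus>\<^bsub>M\<^esub>i\<in>{..<n}. v i (u i x)) = (\<Oplus>\<^bsub>M\<^esub>i\<in>{..<n}. \<zero>\<^bsub>M\<^esub>)"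
        using linear_mapsD(3)[OF Mor_degD(1)[OF Pi_mem[OF uv(1)]] x] vz
        by (intro M.finsum_cong') auto
      then show ?thesis by (simp add: M.finsum_zero)
    qed
    then have "e l = ?z" unfolding el by (intro restrict_ext)
    then show False using e(2)[OF l] by contradiction
  qed
  have "\<epsilon> g \<in> product_set ?B (rcomp ?B g) (rcomp ?B (inv\<^bsub>G\<^esub> g)) \<and>
      (\<forall>b\<in>rcomp ?B g. \<epsilon> g \<otimes>\<^bsub>?B\<^esub> b = b \<and> b = b \<otimes>\<^bsub>?B\<^esub> \<epsilon> (inv\<^bsub>G\<^esub> g))" if g: "g \<in> carrier G" for g
  proof (cases "g \<in> supp G ?B")
    case True
    have "inv\<^bsub>G\<^esub> (inv\<^bsub>G\<^esub> g) = g" using g group.inv_inv[OF group_G] by simp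
    then show ?thesis
      \<comment> \<open>The right unit is e at g^{-1}: its absorption condition concerns degree
        (g^{-1})^{-1} = g.\<close>
      using True sym[OF True] e(1,4)[OF True] e(3)[OF sym[OF True]] product_set_END[OF g]
      by (simp add: \<epsilon>_def)
  next
    case False
    then have z: "b = ?z" if "b \<in> Mor_deg G A M M g" for b using that g unfolding supp_END by blast
    \<comment> \<open>Linearity ensures that \<epsilon> at g^{-1} sends zero to zero, which is the
      right unit law for b = 0.\<close>
    have "\<epsilon> h \<in> linear_maps A M M" if "h \<in> carrier G" for h
      using factors_through_linear[OF that] e(1) linear_maps_zero_map by (simp add: \<epsilon>_def)
    then have "\<epsilon> (inv\<^bsub>G\<^esub> g) \<in> linear_maps A M M" using g group.inv_closed[OF group_G] by simp
    note inv_zero = zero_compose[OF this]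
    \<comment> \<open>Zero is the empty sum of products.\<close>
    have "factors_through G A M (shift G M g) ?z"
      unfolding factors_through_def by (intro exI[of _ "0::nat"]) auto
    then have "\<epsilon> g \<in> product_set ?B (rcomp ?B g) (rcomp ?B (inv\<^bsub>G\<^esub> g))"
      using False product_set_END[OF g] by (simp add: \<epsilon>_def)
    moreover have "\<epsilon> g \<otimes>\<^bsub>?B\<^esub> b = b \<and> b = b \<otimes>\<^bsub>?B\<^esub> \<epsilon> (inv\<^bsub>G\<^esub> g)" if "b \<in> rcomp ?B g" for b
    proof -
      have b: "b = ?z" using z that by simp
      have "\<epsilon> g = ?z" using False by (simp add: \<epsilon>_def)
      then show ?thesis
        unfolding END_simps b using inv_zero zero_compose[OF linear_maps_zero_map] by (simp only:)
    qed
    ultimately show ?thesis by blast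
  qed
  then show ?thesis
    using graded_ring_END
    by (intro epsilon_strongly_graded_ring.intro epsilon_strongly_graded_ring_axioms.intro) blast+
qed

end

theorem theorem5p5:
  fixes G :: "('g, 'x) monoid_scheme"
    and A :: "('a, 'g, 'y) graded_ring_scheme"
    and M :: "('a, 'm, 'g, 'z) graded_module_scheme"
  assumes "group G"
    and "graded_ring G A"
    and "graded_left_module G A M"
  shows "epsilon_strongly_graded_ring G (END G A M) \<longleftrightarrow>
    (\<forall>l\<in>supp G (END G A M). semi_equivalent G A M (shift G M l))"
proof
  interpret graded_left_module G A M by fact
  show "\<forall>l\<in>supp G (END G A M). semi_equivalent G A M (shift G M l)"
    if "epsilon_strongly_graded_ring G (END G A M)"
    using epsilon_imp_semi_equivalent[OF that] by blast
  show "epsilon_strongly_graded_ring G (END G A M)"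
    if "\<forall>l\<in>supp G (END G A M). semi_equivalent G A M (shift G M l)"
    using that by (intro semi_divides_shift_imp_epsilon) (simp add: semi_equivalent_def)
qed

end
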